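(* Let $p>2$ be a prime, $q$ a power of $p$, $F=\mathbb{F}_q((t))$, $F^-=\mathbb{F}_q[t^{-1}]\subset F$, $m\ge 1$, and let $H=F^{2m}\times Z$ (with $Z=F$) be the Heisenberg group associated with a symplectic form $[\![\cdot,\cdot]\!]\colon F^{2m}\times F^{2m}\to F$ that is defined over $F^-$, i.e. $[\![(F^-)^{2m},(F^-)^{2m}]\!]\subset F^-$. Let $\Gamma$ be an arithmetic lattice in $H$ and let $\lambda$ be a virtual automorphism of $\Gamma$. Then there exist a standard automorphism $\phi_{T,\tau}$ of $H$, a finite-index subgroup $\Gamma'$ of $\Gamma$, and a homomorphism $\zeta\colon\Gamma'\to Z(\Gamma)$, such that $\lambda(\gamma)=\phi_{T,\tau}(\gamma)\,\zeta(\gamma)$ for all $\gamma\in\Gamma'$.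
   Context: The group law on $H$ is $(v_1,z_1)\circ(v_2,z_2)=(v_1+v_2,\;z_1+z_2+[\![v_1,v_2]\!])$. A subgroup $\Gamma$ of $H$ is arithmetic if it is commensurable with $(F^-)^{2m}\times F^-$ (the intersection has finite index in both); arithmetic subgroups are lattices, i.e. discrete and cocompact in $H$. A virtual automorphism of $\Gamma$ is a group isomorphism $\lambda\colon\Gamma_1\to\Gamma_2$ between finite-index subgroups of $\Gamma$ (in the theorem, $\Gamma'$ is contained in the domain $\Gamma_1$). $Z(\Gamma)$ is the center of $\Gamma$. $T\in\mathrm{GL}(2m,F)$ is conformally symplectic if there is a nonzero $c_T\in F$ with $[\![T(v),T(w)]\!]=c_T[\![v,w]\!]$ for all $v,w\in F^{2m}$. For such $T$ and a continuous field automorphism $\tau$ of $F$, $\phi_{T,\tau}$ denotes the continuous automorphism of $H$ defined by $\phi_{T,\tau}(v,z)=(\tau(T(v)),\tau(c_Tz))$, with $\tau$ applied coordinatewise on $F^{2m}$. $\phi_{T,\tau}$ is called standard if (1) there exist $\sigma\in\mathrm{Gal}(\mathbb{F}_q/\mathbb{F}_p)$, $\alpha\in\mathbb{F}_q\setminus\{0\}$, $\beta\in\mathbb{F}_q$ with $\tau(f(t^{-1}))=\sigma(f(\alpha t^{-1}+\beta))$ for all $f(t^{-1})\in F$ ($\sigma$ acting on coefficients), and (2) there is a nonzero $b\in F^-$ such that $bT\in\mathrm{Mat}(2m,F^-)$.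
   Formalization: Added hypothesis: every standard φ_{T,τ} is an automorphism of H (i.e. every standard τ preserves the form). It fails for some forms over F^-, and then the claim is false, e.g. for t^{-1} times the standard form with m=1. *)

theory Defs
  imports "HOL-Analysis.Analysis" "HOL-Algebra.Coset"
    "HOL-Computational_Algebra.Formal_Laurent_Series"
begin

text \<open>
  The local field \<open>F = F_q((t))\<close> is \<^typ>\<open>'a fls\<close> for a finite field \<open>'a\<close> with \<open>q\<close> elements (with
  its library metric), and \<open>F\<^sup>n\<close> is \<^typ>\<open>('a fls)^'n\<close>.
\<close>

text \<open>\<open>F\<^sup>- = F_q[t\<^sup>-\<^sup>1]\<close>: a Laurent series has only finitely many terms of negative degree anyway.\<close>

definition F_minus :: "('a :: field) fls set" where
  "F_minus = {f. \<forall>n > 0. fls_nth f n = 0}"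

definition lattice_points :: "(('a :: field) fls ^ 'n) set" where
  "lattice_points = {v. \<forall>i. v $ i \<in> F_minus}"

definition symplectic_form :: "(('k :: field) ^ 'n \<Rightarrow> 'k ^ 'n \<Rightarrow> 'k) \<Rightarrow> bool" where
  "symplectic_form \<omega> \<longleftrightarrow>
     (\<forall>w. Vector_Spaces.linear (*s) (*) (\<lambda>v. \<omega> v w)) \<and>
     (\<forall>v. Vector_Spaces.linear (*s) (*) (\<omega> v)) \<and>
     (\<forall>v. \<omega> v v = 0) \<and>
     (\<forall>v. (\<forall>w. \<omega> v w = 0) \<longrightarrow> v = 0)"

definition heisenberg ::
  "(('k :: field) ^ 'n \<Rightarrow> 'k ^ 'n \<Rightarrow> 'k) \<Rightarrow> (('k ^ 'n) \<times> 'k) monoid" where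
  "heisenberg \<omega> =
     \<lparr>carrier = UNIV,
      mult = (\<lambda>(v1, z1) (v2, z2). (v1 + v2, z1 + z2 + \<omega> v1 v2)),
      one = (0, 0)\<rparr>"

text \<open>\<open>K\<close> is a subgroup of finite index of the subgroup \<open>L\<close> of \<open>G\<close>.\<close>

definition finite_index :: "('g, 'b) monoid_scheme \<Rightarrow> 'g set \<Rightarrow> 'g set \<Rightarrow> bool" where
  "finite_index G K L \<longleftrightarrow>
     subgroup K (G\<lparr>carrier := L\<rparr>) \<and> finite (rcosets\<^bsub>G\<lparr>carrier := L\<rparr>\<^esub> K)"

definition commensurable :: "('g, 'b) monoid_scheme \<Rightarrow> 'g set \<Rightarrow> 'g set \<Rightarrow> bool" where
  "commensurable G K L \<longleftrightarrow> finite_index G (K \<inter> L) K \<and> finite_index G (K \<inter> L) L"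

definition arithmetic_subgroup ::
  "(('a :: field) fls ^ 'n \<Rightarrow> 'a fls ^ 'n \<Rightarrow> 'a fls) \<Rightarrow> (('a fls ^ 'n) \<times> 'a fls) set \<Rightarrow> bool" where
  "arithmetic_subgroup \<omega> \<Gamma> \<longleftrightarrow>
     subgroup \<Gamma> (heisenberg \<omega>) \<and>
     commensurable (heisenberg \<omega>) \<Gamma> (lattice_points \<times> F_minus)"

definition virtual_automorphism ::
  "('g, 'b) monoid_scheme \<Rightarrow> 'g set \<Rightarrow> 'g set \<Rightarrow> 'g set \<Rightarrow> ('g \<Rightarrow> 'g) \<Rightarrow> bool" where
  "virtual_automorphism G \<Gamma> \<Gamma>1 \<Gamma>2 f \<longleftrightarrow>
     finite_index G \<Gamma>1 \<Gamma> \<and> finite_index G \<Gamma>2 \<Gamma> \<and>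
     f \<in> iso (G\<lparr>carrier := \<Gamma>1\<rparr>) (G\<lparr>carrier := \<Gamma>2\<rparr>)"

definition subgroup_center :: "('g, 'b) monoid_scheme \<Rightarrow> 'g set \<Rightarrow> 'g set" where
  "subgroup_center G \<Gamma> = {z \<in> \<Gamma>. \<forall>g \<in> \<Gamma>. z \<otimes>\<^bsub>G\<^esub> g = g \<otimes>\<^bsub>G\<^esub> z}"

text \<open>
  On a finite field, every field automorphism fixes the prime field, so
  \<open>field_automorphism\<close> at type \<open>'a\<close> describes \<open>Gal(F_q/F_p)\<close>.
\<close>

definition field_automorphism :: "('k :: field \<Rightarrow> 'k) \<Rightarrow> bool" where
  "field_automorphism \<tau> \<longleftrightarrow>
     bij \<tau> \<and> (\<forall>x y. \<tau> (x + y) = \<tau> x + \<tau> y) \<and> (\<forall>x y. \<tau> (x * y) = \<tau> x * \<tau> y)"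

definition conformal_with ::
  "(('k :: field) ^ 'n \<Rightarrow> 'k ^ 'n \<Rightarrow> 'k) \<Rightarrow> 'k ^ 'n ^ 'n \<Rightarrow> 'k \<Rightarrow> bool" where
  "conformal_with \<omega> T c \<longleftrightarrow> c \<noteq> 0 \<and> (\<forall>v w. \<omega> (T *v v) (T *v w) = c * \<omega> v w)"

definition conformally_symplectic ::
  "(('k :: field) ^ 'n \<Rightarrow> 'k ^ 'n \<Rightarrow> 'k) \<Rightarrow> 'k ^ 'n ^ 'n \<Rightarrow> bool" where
  "conformally_symplectic \<omega> T \<longleftrightarrow> invertible T \<and> (\<exists>c. conformal_with \<omega> T c)"

text \<open>The scalar \<open>c_T\<close>; it is unique as soon as \<open>\<omega>\<close> is not identically zero.\<close>

definition conformal_factor ::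
  "(('k :: field) ^ 'n \<Rightarrow> 'k ^ 'n \<Rightarrow> 'k) \<Rightarrow> 'k ^ 'n ^ 'n \<Rightarrow> 'k" where
  "conformal_factor \<omega> T = (THE c. conformal_with \<omega> T c)"

lemma conformal_factor_eq:
  assumes "symplectic_form (\<omega> :: ('k :: field) ^ 'n \<Rightarrow> 'k ^ 'n \<Rightarrow> 'k)" and "conformal_with \<omega> T c"
  shows "conformal_factor \<omega> T = c"
  unfolding conformal_factor_def
proof (rule the_equality)
  fix d assume d: "conformal_with \<omega> T d"
  have "(axis undefined 1 :: 'k ^ 'n) \<noteq> 0" by (simp add: axis_eq_0_iff)
  then obtain v w where "\<omega> v w \<noteq> 0" using assms(1) unfolding symplectic_form_def by blast
  moreover have "d * \<omega> v w = c * \<omega> v w" using d assms(2) unfolding conformal_with_def by metis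
  ultimately show "d = c" by simp
qed (fact assms(2))

text \<open>
  \<open>\<phi>_{T,\<tau>}\<close>. Pitfall: even for conformally symplectic \<open>T\<close> this map is a homomorphism of the
  Heisenberg group only when \<open>\<omega> (\<tau> v) (\<tau> w) = \<tau> (\<omega> v w)\<close>, that is, when \<open>\<tau>\<close> fixes the
  coefficients of \<open>\<omega>\<close> in the standard basis. This holds for the standard form
  \<open>\<Sum>i. x\<^sub>i y\<^sub>m\<^sub>+\<^sub>i - x\<^sub>m\<^sub>+\<^sub>i y\<^sub>i\<close> and fails, for instance, for \<open>t\<^sup>-\<^sup>1\<close> times it.
\<close>

definition phi ::
  "(('k :: field) ^ 'n \<Rightarrow> 'k ^ 'n \<Rightarrow> 'k) \<Rightarrow> 'k ^ 'n ^ 'n \<Rightarrow> ('k \<Rightarrow> 'k)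
     \<Rightarrow> ('k ^ 'n) \<times> 'k \<Rightarrow> ('k ^ 'n) \<times> 'k" where
  "phi \<omega> T \<tau> = (\<lambda>(v, z). (\<chi> i. \<tau> ((T *v v) $ i), \<tau> (conformal_factor \<omega> T * z)))"

text \<open>
  An element \<open>f(t\<^sup>-\<^sup>1)\<close> of \<open>F\<close> is a Laurent series in \<open>t\<close>; replacing \<open>t\<^sup>-\<^sup>1\<close> by
  \<open>\<alpha>t\<^sup>-\<^sup>1 + \<beta>\<close> means replacing \<open>t\<close> by \<open>(\<alpha>t\<^sup>-\<^sup>1 + \<beta>)\<^sup>-\<^sup>1 = t / (\<alpha> + \<beta>t)\<close>, a power
  series without constant term.
\<close>

definition affine_subst :: "'a :: field \<Rightarrow> 'a \<Rightarrow> 'a fls \<Rightarrow> 'a fls" where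
  "affine_subst \<alpha> \<beta> f = fls_compose_fps f (fps_X / (fps_const \<alpha> + fps_const \<beta> * fps_X))"

lemma affine_subst_X_inv:
  fixes \<alpha> :: "'a :: field"
  assumes "\<alpha> \<noteq> 0"
  shows "affine_subst \<alpha> \<beta> fls_X_inv = fls_const \<alpha> * fls_X_inv + fls_const \<beta>"
proof -
  let ?d = "fps_const \<alpha> + fps_const \<beta> * fps_X" and ?G = "fps_X / (fps_const \<alpha> + fps_const \<beta> * fps_X)"
  have u: "fps_nth ?d 0 \<noteq> 0" using assms by simp
  have G: "?G = fps_X * inverse ?d" using u by (simp add: fps_divide_unit)
  have n: "?G \<noteq> 0" "fps_nth ?G 0 = 0" using u unfolding G by (simp_all add: fps_inverse_eq_0_iff)
  have "fls_compose_fps (fls_X_inv * fls_X) ?G = fls_compose_fps fls_X_inv ?G * fps_to_fls ?G"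
    by (subst fls_compose_fps_mult) (use n in simp_all)
  moreover have "(fls_X_inv * fls_X :: 'a fls) = 1" by (simp add: fls_X_inv_times_conv_shift)
  ultimately have 1: "fls_compose_fps fls_X_inv ?G * fps_to_fls ?G = 1" by simp
  have "?G * ?d = fps_X" unfolding G using u by (simp add: mult.assoc inverse_mult_eq_1)
  hence "fps_to_fls ?G * fps_to_fls ?d = fls_X"
    by (simp only: fps_X_to_fls flip: fls_times_fps_to_fls)
  moreover have "fps_to_fls ?d = fls_const \<alpha> + fls_const \<beta> * fls_X"
    by (simp add: fls_times_fps_to_fls)
  ultimately have 2: "fps_to_fls ?G * (fls_const \<alpha> + fls_const \<beta> * fls_X) = fls_X" by simp
  have "fls_compose_fps fls_X_inv ?G * fls_X =
      fls_compose_fps fls_X_inv ?G * (fps_to_fls ?G * (fls_const \<alpha> + fls_const \<beta> * fls_X))"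
    unfolding 2 ..
  also have "\<dots> = fls_const \<alpha> + fls_const \<beta> * fls_X"
    by (simp only: mult.assoc[symmetric] 1 mult_1_left)
  also have "\<dots> = (fls_const \<alpha> * fls_X_inv + fls_const \<beta>) * fls_X"
    using \<open>(fls_X_inv * fls_X :: 'a fls) = 1\<close> by (simp add: distrib_right mult.assoc)
  finally show ?thesis unfolding affine_subst_def by simp
qed

definition standard ::
  "(('a :: {field, finite}) fls ^ 'n \<Rightarrow> 'a fls ^ 'n \<Rightarrow> 'a fls) \<Rightarrow> 'a fls ^ 'n ^ 'n
     \<Rightarrow> ('a fls \<Rightarrow> 'a fls) \<Rightarrow> bool" where
  "standard \<omega> T \<tau> \<longleftrightarrow>
     conformally_symplectic \<omega> T \<and> field_automorphism \<tau> \<and> continuous_on UNIV \<tau> \<and>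
     (\<exists>\<sigma> \<alpha> \<beta>. field_automorphism \<sigma> \<and> \<alpha> \<noteq> 0 \<and>
        (\<forall>f n. fls_nth (\<tau> f) n = \<sigma> (fls_nth (affine_subst \<alpha> \<beta> f) n))) \<and>
     (\<exists>b \<in> F_minus. b \<noteq> 0 \<and> (\<forall>i j. b * T $ i $ j \<in> F_minus))"

end

theory Submission
  imports Defs "HOL-Number_Theory.Residues"
begin

text \<open>
  The commutator of \<open>(v, y)\<close> and \<open>(w, z)\<close> in the Heisenberg group is \<open>(0, 2 \<omega> v w)\<close>. After
  passing to subgroups of finite index inside \<open>(F\<^sup>-)\<^sup>2\<^sup>m \<times> F\<^sup>-\<close>, a virtual automorphism therefore
  induces an additive bijection \<open>f\<close> between subgroups of finite index of \<open>(F\<^sup>-)\<^sup>2\<^sup>m\<close> such that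
  \<open>\<omega> (f v) (f w) = \<omega> (f v') (f w')\<close> if and only if \<open>\<omega> v w = \<omega> v' w'\<close>
  (\<open>isomorphism_induces_form_value_bijection\<close>). The point is that multiplication by elements of
  \<open>F\<^sup>-\<close> can be recovered from such data, so that \<open>f\<close> is semilinear.

  For \<open>a \<in> F\<^sup>-\<close>, the vector \<open>a v\<close> is orthogonal to the orthogonal complement of \<open>v\<close>, a property that
  \<open>f\<close> preserves; hence \<open>f (a v) = k f v\<close> for a scalar \<open>k\<close>. From \<open>\<omega> (a v) w = \<omega> v (a w)\<close> it follows
  that \<open>k\<close> depends on \<open>a\<close> only, and \<open>a \<mapsto> k\<close> is a homomorphism of rings \<open>F\<^sup>- \<rightarrow> F\<close>. Its values have a
  common denominator: one for all \<open>a\<close> such that \<open>a v\<close> stays in the domain of \<open>f\<close>, for a fixed \<open>v\<close>, and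
  finitely many more, as these \<open>a\<close> form a subgroup of finite index. As \<open>F\<^sup>-\<close> is integrally
  closed, the values lie in \<open>F\<^sup>-\<close> (\<open>multiplier_F_minus\<close>). The same applies to the inverse of \<open>f\<close>,
  so \<open>a \<mapsto> k\<close> is an automorphism of the polynomial ring \<open>F\<^sup>-\<close>. It acts on the constants by a field
  automorphism and maps \<open>t\<^sup>-\<^sup>1\<close> to a polynomial of degree one, so it is the restriction of a continuous
  automorphism \<open>\<tau>\<close> of \<open>F\<close> of the required form (\<open>ring_automorphism_F_minus_extends\<close>).

  Now \<open>\<tau>\<^sup>-\<^sup>1 \<circ> f\<close>, applied coordinatewise, respects multiplication by elements of \<open>F\<^sup>-\<close> and coincides
  with a matrix \<open>T\<close> on a subgroup of finite index (\<open>f_eq_T\<close>). Comparing values of \<open>\<omega>\<close> on multiples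
  of basis vectors, the Gram matrices of \<open>\<omega>\<close> and of its pullback along \<open>T\<close> are proportional, so \<open>T\<close>
  is conformally symplectic (\<open>T_conformal\<close>). The virtual automorphism and \<open>\<phi>\<^bsub>T,\<tau>\<^esub>\<close> then agree modulo
  the center of the Heisenberg group. Their quotient is a homomorphism to the center whose values have
  a common denominator, and it takes values in the given arithmetic subgroup on a subgroup of finite
  index (\<open>difference_to_standard\<close>).
\<close>

unbundle Formal_Laurent_Series.fps_syntax

section \<open>The polynomial ring inside the field of Laurent series\<close>

lemma F_minus_0: "0 \<in> F_minus"
  and F_minus_1: "1 \<in> F_minus"
  and F_minus_const: "fls_const c \<in> F_minus"
  and F_minus_X_inv: "fls_X_inv \<in> F_minus"
  by (simp_all add: F_minus_def)

lemma F_minus_add: "f \<in> F_minus \<Longrightarrow> g \<in> F_minus \<Longrightarrow> f + g \<in> F_minus"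
  and F_minus_diff: "f \<in> F_minus \<Longrightarrow> g \<in> F_minus \<Longrightarrow> f - g \<in> F_minus"
  by (simp_all add: F_minus_def)

lemma F_minus_mult:
  assumes "f \<in> F_minus" "g \<in> F_minus"
  shows "f * g \<in> F_minus"
  unfolding F_minus_def
proof (intro CollectI allI impI)
  fix n :: int assume "n > 0"
  have "f $$ i * g $$ (n - i) = 0" for i
    using assms \<open>n > 0\<close> by (cases "i > 0") (auto simp: F_minus_def)
  then show "(f * g) $$ n = 0" unfolding fls_times_nth(2) by (intro sum.neutral) blast
qed

lemma F_minus_prod: "(\<And>i. i \<in> A \<Longrightarrow> f i \<in> F_minus) \<Longrightarrow> prod f A \<in> F_minus"
  by (induction A rule: infinite_finite_induct) (auto intro: F_minus_1 F_minus_mult)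

lemma F_minus_subdegree_le:
  assumes "f \<in> F_minus"
  shows "fls_subdegree f \<le> 0"
proof (rule ccontr)
  assume pos: "\<not> fls_subdegree f \<le> 0"
  then have "f $$ fls_subdegree f = 0" using assms by (simp add: F_minus_def)
  then have "f = 0" using nth_fls_subdegree_zero_iff by blast
  with pos show False by simp
qed

lemma F_minus_subdegree_0:
  assumes "f \<in> F_minus" "fls_subdegree f = 0"
  shows "f = fls_const (f $$ 0)"
proof (rule fls_eqI)
  fix n :: int
  consider "n < 0" | "n = 0" | "n > 0" by linarith
  then show "f $$ n = fls_const (f $$ 0) $$ n"
    using assms by cases (simp_all add: F_minus_def)
qed

text \<open>A unit of \<open>F\<^sup>-\<close> has degree zero because the degrees of a unit and of its inverse add up to
  zero and neither is negative.\<close>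

lemma F_minus_unit:
  assumes "f \<in> F_minus" "g \<in> F_minus" "f * g = 1"
  shows "f = fls_const (f $$ 0)"
proof (rule F_minus_subdegree_0)
  have "f \<noteq> 0" "g \<noteq> 0" using assms by auto
  then have "fls_subdegree f + fls_subdegree g = 0"
    using fls_subdegree_mult[of f g] assms(3) by simp
  then show "fls_subdegree f = 0" using assms F_minus_subdegree_le by (metis add_nonpos_eq_0_iff)
qed fact

lemma F_minus_infinite: "infinite (F_minus :: 'a :: field fls set)"
proof -
  have "inj (\<lambda>n :: nat. fls_X_inv ^ n :: 'a fls)"
  proof (rule injI)
    fix m n :: nat assume "(fls_X_inv ^ m :: 'a fls) = fls_X_inv ^ n"
    then have "fls_subdegree (fls_X_inv ^ m :: 'a fls) = fls_subdegree (fls_X_inv ^ n :: 'a fls)" by simp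
    then show "m = n" by (simp add: fls_subdegree_pow)
  qed
  moreover have "fls_X_inv ^ n \<in> (F_minus :: 'a fls set)" for n
    by (induction n) (auto intro: F_minus_1 F_minus_X_inv F_minus_mult)
  ultimately show ?thesis
    by (meson finite_subset image_subset_iff infinite_UNIV_nat range_inj_infinite)
qed

text \<open>Division with remainder needs no polynomials: the quotient is the part of the Laurent series
  \<open>y / s\<close> in nonpositive powers of \<open>t\<close>.\<close>

lemma F_minus_division:
  assumes "y \<in> F_minus" "s \<in> F_minus" "s \<noteq> 0"
  obtains r where "r \<in> F_minus" "y - s * r = 0 \<or> fls_subdegree s < fls_subdegree (y - s * r)"
proof -
  define u where "u = y / s"
  define r where "r = Abs_fls (\<lambda>n. if n \<le> 0 then u $$ n else 0)"
  have r_nth: "r $$ n = (if n \<le> 0 then u $$ n else 0)" for n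
    unfolding r_def by (rule nth_Abs_fls_ex_lower_bound) (auto intro: exI[of _ "fls_subdegree u"])
  have "r \<in> F_minus" by (simp add: F_minus_def r_nth)
  moreover have "fls_subdegree s < fls_subdegree (y - s * r)" if "y - s * r \<noteq> 0"
  proof -
    have eq: "y - s * r = s * (u - r)" using \<open>s \<noteq> 0\<close> by (simp add: u_def algebra_simps)
    then have "u - r \<noteq> 0" using that by auto
    then have "0 < fls_subdegree (u - r)"
      by (intro fls_subdegree_greaterI) (simp_all add: r_nth)
    then show ?thesis using \<open>u - r \<noteq> 0\<close> \<open>s \<noteq> 0\<close> by (simp add: eq)
  qed
  ultimately show thesis using that by blast
qed

text \<open>Integral closedness of \<open>F\<^sup>-\<close>, in the form in which it is used. The conductor of \<open>B\<close> is an
  ideal \<open>I\<close> of \<open>F\<^sup>-\<close>, stable under multiplication by \<open>B\<close>, and it is generated by a nonzero element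
  \<open>s\<close> of least degree. For \<open>b \<in> B\<close> the product \<open>s b\<close> lies in \<open>I\<close>, so it is a multiple \<open>s r\<close> with
  \<open>r \<in> F\<^sup>-\<close>, and \<open>b = r\<close>.\<close>

lemma bounded_denominators_subset_F_minus:
  assumes mult: "\<And>x y. x \<in> B \<Longrightarrow> y \<in> B \<Longrightarrow> x * y \<in> B"
    and h: "h \<in> F_minus" "h \<noteq> 0" "\<And>x. x \<in> B \<Longrightarrow> h * x \<in> F_minus"
  shows "B \<subseteq> (F_minus :: 'a :: field fls set)"
proof
  fix b assume b: "b \<in> B"
  define I where "I = {s. s \<in> F_minus \<and> s \<noteq> 0 \<and> (\<forall>x\<in>B. s * x \<in> F_minus)}"
  have "h \<in> I" using h by (auto simp: I_def)
  then obtain s where s: "s \<in> I" and min: "\<And>s'. s' \<in> I \<Longrightarrow> nat (- fls_subdegree s) \<le> nat (- fls_subdegree s')"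
    using ex_has_least_nat[of "\<lambda>s. s \<in> I" h "\<lambda>s. nat (- fls_subdegree s)"] by blast
  have sF: "s \<in> F_minus" "s \<noteq> 0" using s by (auto simp: I_def)
  have sb: "s * b \<in> F_minus" using s b by (auto simp: I_def)
  obtain r where r: "r \<in> F_minus" "s * b - s * r = 0 \<or> fls_subdegree s < fls_subdegree (s * b - s * r)"
    using F_minus_division[OF sb sF] by blast
  have "s * b - s * r = 0"
  proof (rule ccontr)
    assume nz: "s * b - s * r \<noteq> 0"
    have remF: "s * b - s * r \<in> F_minus" using F_minus_diff[OF sb F_minus_mult[OF sF(1) r(1)]] .
    have "(s * b - s * r) * x \<in> F_minus" if x: "x \<in> B" for x
    proof -
      have "(s * b - s * r) * x = s * (b * x) - (s * x) * r" by (simp add: algebra_simps)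
      also have "\<dots> \<in> F_minus"
      proof (rule F_minus_diff)
        show "s * (b * x) \<in> F_minus" using s mult[OF b x] by (simp add: I_def)
        show "s * x * r \<in> F_minus" using s x r by (intro F_minus_mult[of "s * x"]) (simp_all add: I_def)
      qed
      finally show ?thesis .
    qed
    then have "s * b - s * r \<in> I" using nz remF by (auto simp: I_def)
    from min[OF this] r nz F_minus_subdegree_le[OF remF] F_minus_subdegree_le[OF sF(1)]
    show False by auto
  qed
  then have "s * b = s * r" by simp
  then have "b = r" using sF by simp
  then show "b \<in> F_minus" using r by simp
qed

text \<open>Horner's scheme, as an induction on the degree.\<close>

lemma F_minus_induct [consumes 1, case_names const step]:
  assumes "f \<in> (F_minus :: 'a :: field fls set)"
    and const: "\<And>c. P (fls_const c)"
    and step: "\<And>c g. g \<in> F_minus \<Longrightarrow> g \<noteq> 0 \<Longrightarrow> P g \<Longrightarrow> P (fls_const c + fls_X_inv * g)"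
  shows "P f"
  using assms(1)
proof (induction "nat (- fls_subdegree f)" arbitrary: f rule: less_induct)
  case less
  show ?case
  proof (cases "fls_subdegree f = 0")
    case True
    then show ?thesis using F_minus_subdegree_0[OF less.prems] const by metis
  next
    case False
    then have neg: "fls_subdegree f < 0" using F_minus_subdegree_le[OF less.prems] by simp
    define g where "g = fls_X * (f - fls_const (f $$ 0))"
    have eq: "f = fls_const (f $$ 0) + fls_X_inv * g"
    proof -
      have "fls_X_inv * g = (fls_X_inv * fls_X) * (f - fls_const (f $$ 0))"
        by (simp only: g_def mult.assoc)
      moreover have "(fls_X_inv * fls_X :: 'a fls) = 1" by (simp add: fls_X_inv_times_conv_shift)
      ultimately show ?thesis by simp
    qed
    have g_nth: "g $$ n = (if n = 1 then 0 else f $$ (n - 1))" for n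
      by (simp add: g_def fls_X_times_conv_shift)
    have gF: "g \<in> F_minus" using less.prems by (auto simp: F_minus_def g_nth)
    have "f $$ fls_subdegree f \<noteq> 0" using neg by (metis fls_zero_subdegree less_irrefl nth_fls_subdegree_nonzero)
    then have "fls_subdegree g = fls_subdegree f + 1"
      using neg by (intro fls_subdegree_eqI) (auto simp: g_nth)
    moreover from this have "g \<noteq> 0" using \<open>f $$ fls_subdegree f \<noteq> 0\<close> neg g_nth[of "fls_subdegree f + 1"] by auto
    ultimately show ?thesis
      using step[OF gF _ less.hyps[OF _ gF]] neg by (subst eq) auto
  qed
qed

section \<open>Substitution and coefficient automorphisms of Laurent series\<close>

lemma field_automorphism_0: "field_automorphism \<tau> \<Longrightarrow> \<tau> 0 = 0"
  unfolding field_automorphism_def by (metis add_cancel_right_left add_0)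

lemma field_automorphism_inj: "field_automorphism \<tau> \<Longrightarrow> \<tau> x = \<tau> y \<longleftrightarrow> x = y"
  unfolding field_automorphism_def by (meson bij_is_inj injD)

lemma field_automorphism_1: "field_automorphism \<tau> \<Longrightarrow> \<tau> 1 = 1"
  by (metis field_automorphism_0 field_automorphism_inj field_automorphism_def mult_1
      mult_cancel_right1 zero_neq_one)

lemma field_automorphism_sum: "field_automorphism \<tau> \<Longrightarrow> \<tau> (sum f A) = (\<Sum>i\<in>A. \<tau> (f i))"
  by (induction A rule: infinite_finite_induct)
    (simp_all add: field_automorphism_0, simp add: field_automorphism_def)

definition fls_map :: "('a \<Rightarrow> 'a) \<Rightarrow> ('a :: field) fls \<Rightarrow> 'a fls" where
  "fls_map \<sigma> f = Abs_fls (\<lambda>n. \<sigma> (f $$ n))"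

context
  fixes \<sigma> :: "'a :: field \<Rightarrow> 'a"
  assumes \<sigma>: "field_automorphism \<sigma>"
begin

lemma fls_map_nth: "fls_map \<sigma> f $$ n = \<sigma> (f $$ n)"
  unfolding fls_map_def
  by (rule nth_Abs_fls_ex_lower_bound)
    (auto intro: exI[of _ "fls_subdegree f"] simp: field_automorphism_0[OF \<sigma>])

lemma fls_map_const: "fls_map \<sigma> (fls_const c) = fls_const (\<sigma> c)"
  by (rule fls_eqI) (simp add: fls_map_nth field_automorphism_0[OF \<sigma>])

lemma fls_map_subdegree: "fls_subdegree (fls_map \<sigma> f) = fls_subdegree f"
proof (cases "f = 0")
  case True
  then show ?thesis using fls_map_const[of 0] by (simp add: field_automorphism_0[OF \<sigma>])
next
  case False
  show ?thesis
  proof (rule fls_subdegree_eqI)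
    show "fls_map \<sigma> f $$ fls_subdegree f \<noteq> 0"
      using False field_automorphism_inj[OF \<sigma>, of _ 0]
      by (simp add: fls_map_nth field_automorphism_0[OF \<sigma>])
  qed (simp add: fls_map_nth field_automorphism_0[OF \<sigma>])
qed

lemma fls_map_automorphism: "field_automorphism (fls_map \<sigma>)"
proof -
  have add: "fls_map \<sigma> (f + g) = fls_map \<sigma> f + fls_map \<sigma> g" for f g
    using \<sigma> by (intro fls_eqI) (simp add: fls_map_nth field_automorphism_def)
  have mult: "fls_map \<sigma> (f * g) = fls_map \<sigma> f * fls_map \<sigma> g" for f g
  proof (rule fls_eqI)
    fix n
    have "\<sigma> (x * y) = \<sigma> x * \<sigma> y" for x y using \<sigma> by (simp add: field_automorphism_def)
    then show "fls_map \<sigma> (f * g) $$ n = (fls_map \<sigma> f * fls_map \<sigma> g) $$ n"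
      by (simp add: fls_map_nth fls_times_nth(2) fls_map_subdegree field_automorphism_sum[OF \<sigma>])
  qed
  have inj: "inj (fls_map \<sigma>)"
  proof (rule injI)
    fix f g assume "fls_map \<sigma> f = fls_map \<sigma> g"
    then have "\<sigma> (f $$ n) = \<sigma> (g $$ n)" for n by (metis fls_map_nth)
    then show "f = g" by (simp add: fls_eq_iff field_automorphism_inj[OF \<sigma>])
  qed
  have surj: "f \<in> range (fls_map \<sigma>)" for f
  proof -
    have s: "\<sigma> (inv_into UNIV \<sigma> x) = x" for x
      using \<sigma> by (simp add: field_automorphism_def bij_is_surj surj_f_inv_f)
    have i0: "inv_into UNIV \<sigma> 0 = 0"
      using field_automorphism_inj[OF \<sigma>, of "inv_into UNIV \<sigma> 0" 0] s field_automorphism_0[OF \<sigma>] by simp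
    define g where "g = Abs_fls (\<lambda>n. inv_into UNIV \<sigma> (f $$ n))"
    have "g $$ n = inv_into UNIV \<sigma> (f $$ n)" for n
      unfolding g_def
      by (rule nth_Abs_fls_ex_lower_bound) (auto intro: exI[of _ "fls_subdegree f"] simp: i0)
    then have "f = fls_map \<sigma> g" by (intro fls_eqI) (simp add: fls_map_nth s)
    then show ?thesis by blast
  qed
  show ?thesis
    unfolding field_automorphism_def bij_def using add mult inj surj by blast
qed

end

lemma fls_compose_fps_X: "fls_compose_fps f fps_X = (f :: 'a :: field fls)"
proof (cases "f = 0")
  case False
  define n where "n = fls_subdegree f"
  define g where "g = fls_regpart (fls_shift n f)"
  have f_eq: "f = fls_shift (-n) (fps_to_fls g)" using False by (simp add: g_def n_def)
  show ?thesis unfolding f_eq by (simp add: fls_compose_fps_shift fls_shifted_times_simps)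
qed simp

context
  fixes \<alpha> \<beta> :: "'a :: field"
  assumes \<alpha>: "\<alpha> \<noteq> 0"
begin

private abbreviation G where "G \<equiv> fps_X / (fps_const \<alpha> + fps_const \<beta> * fps_X) :: 'a fps"

lemma affine_subst_fps:
  shows "G \<noteq> 0" "fps_nth G 0 = 0" "fps_nth G 1 \<noteq> 0" "subdegree G = 1"
proof -
  have G: "G = fps_X * inverse (fps_const \<alpha> + fps_const \<beta> * fps_X)"
    using \<alpha> by (simp add: fps_divide_unit)
  show "fps_nth G 0 = 0" unfolding G by simp
  show "fps_nth G 1 \<noteq> 0" using \<alpha> unfolding G by simp
  then show "G \<noteq> 0" by auto
  show "subdegree G = 1"
    using \<open>fps_nth G 0 = 0\<close> \<open>fps_nth G 1 \<noteq> 0\<close> by (intro subdegreeI) auto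
qed

lemma affine_subst_subdegree: "fls_subdegree (affine_subst \<alpha> \<beta> f) = fls_subdegree f"
  unfolding affine_subst_def by (simp only: subdegree_fls_compose_fps affine_subst_fps mult_1_right of_nat_1)

lemma affine_subst_const: "affine_subst \<alpha> \<beta> (fls_const c) = fls_const c"
  unfolding affine_subst_def using fls_compose_fps_to_fls[OF affine_subst_fps(1,2), of "fps_const c"]
  by simp

text \<open>Surjectivity: substituting the compositional inverse of the power series first.\<close>

lemma affine_subst_automorphism: "field_automorphism (affine_subst \<alpha> \<beta>)"
proof -
  note G = affine_subst_fps
  have inj: "f = g" if "affine_subst \<alpha> \<beta> f = affine_subst \<alpha> \<beta> g" for f g
    using that fls_compose_fps_eq_0_iff[OF G(1,2), of "f - g"]
    by (simp only: affine_subst_def fls_compose_fps_diff[OF G(1,2)]) simp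
  define K where "K = fps_inv G"
  have KG: "fps_compose K G = fps_X" unfolding K_def using G by (intro fps_inv)
  have K0: "fps_nth K 0 = 0" by (simp add: K_def fps_inv_def)
  have K: "K \<noteq> 0" using KG by auto
  have "affine_subst \<alpha> \<beta> (fls_compose_fps f K) = f" for f
    unfolding affine_subst_def fls_compose_fps_assoc[OF K K0 G(1,2)] KG fls_compose_fps_X ..
  then have "f \<in> range (affine_subst \<alpha> \<beta>)" for f by (metis rangeI)
  then show ?thesis
    unfolding field_automorphism_def bij_def inj_def
    using inj by (auto simp: affine_subst_def fls_compose_fps_add[OF G(1,2)] fls_compose_fps_mult[OF G(1,2)])
qed

end

text \<open>An additive map that preserves the valuation is an isometry.\<close>

lemma continuous_on_of_subdegree_preserving:
  fixes \<tau> :: "'a :: field fls \<Rightarrow> 'a fls"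
  assumes \<tau>: "field_automorphism \<tau>" and sub: "\<And>f. fls_subdegree (\<tau> f) = fls_subdegree f"
  shows "continuous_on UNIV \<tau>"
proof -
  have "\<tau> (f - g) = \<tau> f - \<tau> g" for f g
    using \<tau> by (metis add_diff_cancel_right' diff_add_cancel field_automorphism_def)
  then have "dist (\<tau> f) (\<tau> g) = dist f g" for f g
    by (simp add: dist_fls_def field_automorphism_inj[OF \<tau>] sub flip: \<open>\<And>f g. \<tau> (f - g) = \<tau> f - \<tau> g\<close>)
  then show ?thesis unfolding continuous_on_iff by metis
qed

section \<open>Automorphisms of the polynomial ring\<close>

text \<open>The part of the definition of \<^const>\<open>standard\<close> that concerns \<open>\<tau>\<close> alone.\<close>

definition standard_field_automorphism :: "('a :: field fls \<Rightarrow> 'a fls) \<Rightarrow> bool" where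
  "standard_field_automorphism \<tau> \<longleftrightarrow> field_automorphism \<tau> \<and> continuous_on UNIV \<tau> \<and>
     (\<exists>\<sigma> \<alpha> \<beta>. field_automorphism \<sigma> \<and> \<alpha> \<noteq> 0 \<and>
        (\<forall>f n. fls_nth (\<tau> f) n = \<sigma> (fls_nth (affine_subst \<alpha> \<beta> f) n)))"

lemma standard_field_automorphism_exists:
  fixes \<sigma> :: "'a :: field \<Rightarrow> 'a"
  assumes \<sigma>: "field_automorphism \<sigma>" and \<alpha>: "\<alpha> \<noteq> 0"
  obtains \<tau> where "standard_field_automorphism \<tau>" "\<And>c. \<tau> (fls_const c) = fls_const (\<sigma> c)"
    "\<tau> fls_X_inv = fls_const (\<sigma> \<alpha>) * fls_X_inv + fls_const (\<sigma> \<beta>)"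
proof -
  define \<tau> where "\<tau> = fls_map \<sigma> \<circ> affine_subst \<alpha> \<beta>"
  note m = fls_map_automorphism[OF \<sigma>] and a = affine_subst_automorphism[OF \<alpha>, of \<beta>]
  have aut: "field_automorphism \<tau>"
    using m a unfolding \<tau>_def field_automorphism_def by (auto intro: bij_comp)
  moreover have "continuous_on UNIV \<tau>"
    by (rule continuous_on_of_subdegree_preserving[OF aut])
      (simp add: \<tau>_def fls_map_subdegree[OF \<sigma>] affine_subst_subdegree[OF \<alpha>])
  moreover have "\<forall>f n. fls_nth (\<tau> f) n = \<sigma> (fls_nth (affine_subst \<alpha> \<beta> f) n)"
    by (simp add: \<tau>_def fls_map_nth[OF \<sigma>])
  ultimately have "standard_field_automorphism \<tau>"
    unfolding standard_field_automorphism_def using \<sigma> \<alpha> by blast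
  moreover have "\<tau> (fls_const c) = fls_const (\<sigma> c)" for c
    by (simp add: \<tau>_def affine_subst_const[OF \<alpha>] fls_map_const[OF \<sigma>])
  moreover have "fls_map \<sigma> fls_X_inv = fls_X_inv"
    by (rule fls_eqI) (simp add: fls_map_nth[OF \<sigma>] field_automorphism_0[OF \<sigma>] field_automorphism_1[OF \<sigma>])
  then have "\<tau> fls_X_inv = fls_const (\<sigma> \<alpha>) * fls_X_inv + fls_const (\<sigma> \<beta>)"
    using m by (simp add: \<tau>_def affine_subst_X_inv[OF \<alpha>] field_automorphism_def fls_map_const[OF \<sigma>])
  ultimately show thesis using that by blast
qed

text \<open>An automorphism \<open>k\<close> of \<open>F\<^sup>-\<close> permutes the units of \<open>F\<^sup>-\<close>, that is, the nonzero constants, so it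
  multiplies degrees by the degree of \<open>k t\<^sup>-\<^sup>1\<close>. As \<open>t\<^sup>-\<^sup>1\<close> is itself a value of \<open>k\<close>, that degree is
  one.\<close>

theorem ring_automorphism_F_minus_extends:
  fixes k :: "'a :: {field, finite} fls \<Rightarrow> 'a fls"
  assumes bij: "bij_betw k F_minus F_minus"
    and add: "\<And>f g. f \<in> F_minus \<Longrightarrow> g \<in> F_minus \<Longrightarrow> k (f + g) = k f + k g"
    and mult: "\<And>f g. f \<in> F_minus \<Longrightarrow> g \<in> F_minus \<Longrightarrow> k (f * g) = k f * k g"
  obtains \<tau> where "standard_field_automorphism \<tau>" "\<And>f. f \<in> F_minus \<Longrightarrow> \<tau> f = k f"
proof -
  note R = F_minus_0 F_minus_1 F_minus_const F_minus_X_inv F_minus_mult F_minus_add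
  have kR: "k f \<in> F_minus" if "f \<in> F_minus" for f using bij that by (rule bij_betwE[rule_format])
  have inj: "f = g" if "k f = k g" "f \<in> F_minus" "g \<in> F_minus" for f g
    using bij that by (meson bij_betw_def inj_onD)
  have surj: "\<exists>g\<in>F_minus. f = k g" if "f \<in> F_minus" for f
    using bij that by (metis bij_betw_def imageE)
  have k0: "k 0 = 0" using add[OF R(1) R(1)] by (metis add_0 add_cancel_right_right)
  have k0_iff: "k f = 0 \<longleftrightarrow> f = 0" if "f \<in> F_minus" for f using inj[OF _ that R(1)] k0 by auto
  have k1: "k 1 = 1" using mult[OF R(2) R(2)] k0_iff[OF R(2)] by simp
  define \<sigma> where "\<sigma> c = k (fls_const c) $$ 0" for c
  have kc: "k (fls_const c) = fls_const (\<sigma> c)" for c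
  proof (cases "c = 0")
    case False
    then have "fls_const c * fls_const (inverse c) = 1" by (simp add: fls_const_mult_const)
    then have "k (fls_const c) * k (fls_const (inverse c)) = 1" using mult R k1 by metis
    then show ?thesis unfolding \<sigma>_def using F_minus_unit[OF kR[OF R(3)] kR[OF R(3)]] by blast
  qed (simp add: \<sigma>_def k0)
  have c_inj: "c = d" if "fls_const c = (fls_const d :: 'a fls)" for c d
    using arg_cong[OF that, of "\<lambda>f. f $$ 0"] by simp
  have "\<sigma> (c + d) = \<sigma> c + \<sigma> d" "\<sigma> (c * d) = \<sigma> c * \<sigma> d" for c d
    using add[OF R(3) R(3), of c d] mult[OF R(3) R(3), of c d]
    by (simp_all add: c_inj kc fls_plus_const fls_const_mult_const)
  moreover have \<sigma>_inj: "inj \<sigma>" using inj[OF _ R(3) R(3)] kc c_inj by (metis injI)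
  then have \<sigma>_surj: "surj \<sigma>" by (rule finite_UNIV_inj_surj[OF finite])
  ultimately have \<sigma>: "field_automorphism \<sigma>"
    unfolding field_automorphism_def bij_def using \<sigma>_inj by blast
  define y where "y = k fls_X_inv"
  have yR: "y \<in> F_minus" unfolding y_def by (intro kR R)
  define d where "d = - fls_subdegree y"
  have "d \<noteq> 0"
  proof
    assume "d = 0"
    then have "y = fls_const (y $$ 0)" using F_minus_subdegree_0[OF yR] by (simp add: d_def)
    then have "y = k (fls_const (inv_into UNIV \<sigma> (y $$ 0)))" by (simp add: kc surj_f_inv_f[OF \<sigma>_surj])
    then have "fls_X_inv = (fls_const (inv_into UNIV \<sigma> (y $$ 0)) :: 'a fls)" unfolding y_def by (rule inj[OF _ R(4) R(3)])
    from arg_cong[OF this, of fls_subdegree] show False by simp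
  qed
  then have d: "d > 0" using F_minus_subdegree_le[OF yR] by (simp add: d_def)
  have deg: "fls_subdegree (k f) = d * fls_subdegree f" if "f \<in> F_minus" for f
    using that
  proof (induction rule: F_minus_induct)
    case (const c)
    then show ?case by (simp add: kc)
  next
    case (step c g)
    have k_eq: "k (fls_const c + fls_X_inv * g) = y * k g + fls_const (\<sigma> c)"
      using add[OF R(3) F_minus_mult[OF R(4) step.hyps(1)]] mult[OF R(4) step.hyps(1)]
      by (simp add: kc y_def)
    have nz: "k g \<noteq> 0" "y \<noteq> 0" using step.hyps k0_iff d by (auto simp: d_def)
    have g0: "fls_subdegree g \<le> 0" by (rule F_minus_subdegree_le) fact
    then have "d * fls_subdegree g \<le> 0" using d by (simp add: mult_nonneg_nonpos)
    moreover have "fls_subdegree (y * k g) = - d + d * fls_subdegree g"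
      using nz step.IH by (simp add: d_def)
    ultimately have neg: "fls_subdegree (y * k g) < 0" using d by linarith
    then have "fls_subdegree (y * k g + fls_const (\<sigma> c)) = fls_subdegree (y * k g)"
      using nz by (intro fls_subdegree_add_eq1) auto
    then have k_deg: "fls_subdegree (k (fls_const c + fls_X_inv * g)) = - d + d * fls_subdegree g"
      using k_eq nz step.IH by (simp add: d_def)
    have "fls_subdegree (fls_X_inv * g + fls_const c) = fls_subdegree (fls_X_inv * g)"
      using step.hyps g0 by (intro fls_subdegree_add_eq1) auto
    then have "fls_subdegree (fls_const c + fls_X_inv * g) = fls_subdegree g - 1"
      using step.hyps by (simp add: add.commute)
    with k_deg show ?case by (simp add: right_diff_distrib)
  qed
  obtain f where "f \<in> F_minus" "fls_X_inv = k f" using surj[OF R(4)] by blast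
  then have "d * fls_subdegree f = -1" using deg[of f] by (metis fls_X_inv_subdegree)
  then have "d * (- fls_subdegree f) = 1" by simp
  then have "d = 1" using d by (simp only: zmult_eq_1_iff) linarith
  then have suby: "fls_subdegree y = -1" by (simp add: d_def)
  define a0 a1 where "a0 = y $$ 0" and "a1 = y $$ (-1)"
  have "a1 \<noteq> 0" using suby unfolding a1_def by (metis fls_zero_subdegree nth_fls_subdegree_nonzero zero_neq_neg_one)
  have y_eq: "y = fls_const a1 * fls_X_inv + fls_const a0"
  proof (rule fls_eqI)
    fix n :: int
    consider "n < -1" | "n = -1" | "n = 0" | "n > 0" by linarith
    then show "y $$ n = (fls_const a1 * fls_X_inv + fls_const a0) $$ n"
      using suby yR by cases (simp_all add: a0_def a1_def F_minus_def)
  qed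
  \<comment> \<open>\<open>\<sigma>\<close> acts after the substitution, hence the preimages of the coefficients of \<open>y\<close>.\<close>
  have "\<sigma> (inv_into UNIV \<sigma> c) = c" for c by (rule surj_f_inv_f[OF \<sigma>_surj])
  moreover have "inv_into UNIV \<sigma> a1 \<noteq> 0" using \<open>a1 \<noteq> 0\<close> calculation field_automorphism_0[OF \<sigma>] by metis
  ultimately obtain \<tau> where \<tau>: "standard_field_automorphism \<tau>"
    "\<And>c. \<tau> (fls_const c) = fls_const (\<sigma> c)" "\<tau> fls_X_inv = y"
    using standard_field_automorphism_exists[OF \<sigma>, of "inv_into UNIV \<sigma> a1" "inv_into UNIV \<sigma> a0"] y_eq by metis
  have hom: "\<tau> (f + g) = \<tau> f + \<tau> g" "\<tau> (f * g) = \<tau> f * \<tau> g" for f g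
    using \<tau>(1) by (auto simp: standard_field_automorphism_def field_automorphism_def)
  have "\<tau> f = k f" if "f \<in> F_minus" for f
    using that
  proof (induction rule: F_minus_induct)
    case (step c g)
    then show ?case
      using add[OF R(3) F_minus_mult[OF R(4) step.hyps(1)]] mult[OF R(4) step.hyps(1)]
      by (simp add: hom \<tau> kc y_def)
  qed (simp add: \<tau> kc)
  with \<tau>(1) show thesis using that by blast
qed

section \<open>Finite-index subgroups of the lattice points\<close>

lemma lattice_points_add: "v \<in> lattice_points \<Longrightarrow> w \<in> lattice_points \<Longrightarrow> v + w \<in> lattice_points"
  and lattice_points_diff: "v \<in> lattice_points \<Longrightarrow> w \<in> lattice_points \<Longrightarrow> v - w \<in> lattice_points"
  and lattice_points_0: "0 \<in> lattice_points"
  by (auto simp: lattice_points_def intro: F_minus_add F_minus_diff F_minus_0)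

lemma lattice_points_scale: "a \<in> F_minus \<Longrightarrow> v \<in> lattice_points \<Longrightarrow> a *s v \<in> lattice_points"
  by (auto simp: lattice_points_def intro: F_minus_mult)

lemma lattice_points_axis: "a \<in> F_minus \<Longrightarrow> axis i a \<in> lattice_points"
  by (auto simp: lattice_points_def axis_def intro: F_minus_0)

text \<open>The additive counterpart of \<^const>\<open>finite_index\<close>, in terms of a finite set \<open>C\<close> that meets all
  cosets.\<close>

definition finite_index_lattice :: "(('a :: field) fls ^ 'n) set \<Rightarrow> bool" where
  "finite_index_lattice V \<longleftrightarrow> V \<subseteq> lattice_points \<and> 0 \<in> V \<and> (\<forall>x\<in>V. \<forall>y\<in>V. x - y \<in> V) \<and>
     (\<exists>C. finite C \<and> (\<forall>x\<in>lattice_points. \<exists>c\<in>C. x - c \<in> V))"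

context
  fixes V :: "(('a :: field) fls ^ 'n) set"
  assumes V: "finite_index_lattice V"
begin

lemma finite_index_lattice_0: "0 \<in> V"
  and finite_index_lattice_lattice_points: "v \<in> V \<Longrightarrow> v \<in> lattice_points"
  and finite_index_lattice_diff: "v \<in> V \<Longrightarrow> w \<in> V \<Longrightarrow> v - w \<in> V"
  using V by (auto simp: finite_index_lattice_def)

lemma finite_index_lattice_uminus: "v \<in> V \<Longrightarrow> - v \<in> V"
  using finite_index_lattice_diff[OF finite_index_lattice_0] by simp

lemma finite_index_lattice_add: "v \<in> V \<Longrightarrow> w \<in> V \<Longrightarrow> v + w \<in> V"
  using finite_index_lattice_diff[OF _ finite_index_lattice_uminus] by fastforce

lemma finite_index_lattice_sum: "(\<And>i. i \<in> A \<Longrightarrow> g i \<in> V) \<Longrightarrow> sum g A \<in> V"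
  by (induction A rule: infinite_finite_induct)
    (auto intro: finite_index_lattice_0 finite_index_lattice_add)

lemma finite_index_lattice_classes:
  obtains q :: "'a fls ^ 'n \<Rightarrow> 'a fls ^ 'n"
  where "finite (q ` lattice_points)"
    "\<And>x y. x \<in> lattice_points \<Longrightarrow> y \<in> lattice_points \<Longrightarrow> q x = q y \<Longrightarrow> x - y \<in> V"
proof -
  obtain C where C: "finite C" "\<forall>x\<in>lattice_points. \<exists>c\<in>C. x - c \<in> V"
    using V by (auto simp: finite_index_lattice_def)
  then obtain q where q: "\<forall>x\<in>lattice_points. q x \<in> C \<and> x - q x \<in> V" by metis
  show thesis
  proof (rule that)
    show "finite (q ` lattice_points)" using q C(1) by (meson finite_subset image_subsetI)
    fix x y assume xy: "x \<in> lattice_points" "y \<in> lattice_points" "q x = q y"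
    have "(x - q x) - (y - q y) \<in> V" using q xy finite_index_lattice_diff[of "x - q x" "y - q y"] by blast
    then show "x - y \<in> V" using xy by simp
  qed
qed

text \<open>Finite index makes up for the fact that \<open>V\<close> need not be an \<open>F\<^sup>-\<close>-module: as \<open>F\<^sup>-\<close> is
  infinite, two of its elements move all of \<open>U\<close> to the same cosets of \<open>V\<close>, and their difference
  moves \<open>U\<close> into \<open>V\<close>.\<close>

lemma finite_index_lattice_multiplier:
  assumes "finite U" "U \<subseteq> lattice_points"
  obtains s where "s \<in> F_minus" "s \<noteq> 0" "\<And>u. u \<in> U \<Longrightarrow> s *s u \<in> V"
proof -
  obtain q :: "'a fls ^ 'n \<Rightarrow> 'a fls ^ 'n" where q: "finite (q ` lattice_points)"
    "\<And>x y. x \<in> lattice_points \<Longrightarrow> y \<in> lattice_points \<Longrightarrow> q x = q y \<Longrightarrow> x - y \<in> V"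
    by (rule finite_index_lattice_classes) blast
  define r where "r s = (\<lambda>u\<in>U. q (s *s u))" for s
  have "r ` F_minus \<subseteq> PiE U (\<lambda>_. q ` lattice_points)"
    using assms(2) by (auto simp: r_def intro!: imageI lattice_points_scale)
  moreover have "finite (PiE U (\<lambda>_. q ` lattice_points))"
    using assms(1) q(1) by (intro finite_PiE) auto
  ultimately have "\<not> inj_on r F_minus"
    using F_minus_infinite by (meson finite_imageD finite_subset)
  then obtain s s' where s: "s \<in> F_minus" "s' \<in> F_minus" "r s = r s'" "s \<noteq> s'"
    unfolding inj_on_def by blast
  have "(s - s') *s u \<in> V" if "u \<in> U" for u
  proof -
    have "q (s *s u) = q (s' *s u)" using fun_cong[OF s(3), of u] that by (simp add: r_def)
    then have "s *s u - s' *s u \<in> V" using q(2) lattice_points_scale s assms(2) that by blast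
    then show ?thesis by (simp add: vector_sub_rdistrib)
  qed
  then show thesis using that[of "s - s'"] s by (simp add: F_minus_diff)
qed

lemma finite_index_lattice_multiplier2:
  assumes "u \<in> lattice_points" "w \<in> lattice_points"
  obtains s where "s \<in> F_minus" "s \<noteq> 0" "s *s u \<in> V" "s *s w \<in> V"
proof -
  have "finite {u, w}" "{u, w} \<subseteq> lattice_points" using assms by auto
  then obtain s where "s \<in> F_minus" "s \<noteq> 0" "\<And>x. x \<in> {u, w} \<Longrightarrow> s *s x \<in> V"
    using finite_index_lattice_multiplier by blast
  then show thesis using that by blast
qed

end

section \<open>Symplectic forms\<close>

locale integral_symplectic =
  fixes \<omega> :: "('a :: field) fls ^ 'n \<Rightarrow> 'a fls ^ 'n \<Rightarrow> 'a fls"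
  assumes symplectic: "symplectic_form \<omega>"
    and integral: "\<And>v w. v \<in> lattice_points \<Longrightarrow> w \<in> lattice_points \<Longrightarrow> \<omega> v w \<in> F_minus"
begin

lemma add_left: "\<omega> (u + v) w = \<omega> u w + \<omega> v w"
  and add_right: "\<omega> w (u + v) = \<omega> w u + \<omega> w v"
  and scale_left: "\<omega> (a *s v) w = a * \<omega> v w"
  and scale_right: "\<omega> w (a *s v) = a * \<omega> w v"
  and alternating: "\<omega> v v = 0"
  using symplectic unfolding symplectic_form_def Vector_Spaces.linear_iff by auto

lemma zero_left: "\<omega> 0 w = 0" and zero_right: "\<omega> w 0 = 0"
  using scale_left[of 0 0 w] scale_right[of w 0 0] by simp_all

lemma diff_left: "\<omega> (u - v) w = \<omega> u w - \<omega> v w"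
  and diff_right: "\<omega> w (u - v) = \<omega> w u - \<omega> w v"
  using add_left[of "u - v" v w] add_right[of w "u - v" v] by simp_all

lemma uminus_left: "\<omega> (- v) w = - \<omega> v w"
  and uminus_right: "\<omega> w (- v) = - \<omega> w v"
  using diff_left[of 0 v w] diff_right[of w 0 v] by (simp_all add: zero_left zero_right)

lemma skew: "\<omega> w v = - \<omega> v w"
proof -
  have "\<omega> v w + \<omega> w v = 0"
    using alternating[of "v + w"]
    by (simp only: add_left add_right alternating[of v] alternating[of w] add_0_left add_0_right
        add.commute)
  then show ?thesis by (metis eq_neg_iff_add_eq_0 add.commute)
qed

lemma sum_left: "\<omega> (sum g A) w = (\<Sum>i\<in>A. \<omega> (g i) w)"
  and sum_right: "\<omega> w (sum g A) = (\<Sum>i\<in>A. \<omega> w (g i))"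
  by (induction A rule: infinite_finite_induct)
    (simp_all add: add_left add_right zero_left zero_right)

lemma form_combination:
  fixes u :: "'n \<Rightarrow> 'a fls ^ 'n" and v w :: "'a fls ^ 'n"
  shows "\<omega> (\<Sum>i\<in>UNIV. v $ i *s u i) (\<Sum>j\<in>UNIV. w $ j *s u j) =
     (\<Sum>i\<in>UNIV. \<Sum>j\<in>UNIV. v $ i * w $ j * \<omega> (u i) (u j))"
  by (simp add: sum_left sum_right scale_left scale_right sum_distrib_left mult.assoc)
    (subst sum.swap, simp add: mult.left_commute)

lemma ex_lattice_point_nonorthogonal:
  assumes "v \<noteq> 0"
  obtains w where "w \<in> lattice_points" "\<omega> v w \<noteq> 0"
proof -
  obtain u where "\<omega> v u \<noteq> 0" using symplectic assms unfolding symplectic_form_def by blast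
  then have "(\<Sum>j\<in>UNIV. u $ j * \<omega> v (axis j 1)) \<noteq> 0"
    by (metis (mono_tags, lifting) basis_expansion scale_right sum.cong sum_right)
  then obtain j where "\<omega> v (axis j 1) \<noteq> 0" by (metis (mono_tags, lifting) mult_zero_right sum.neutral)
  then show thesis using that lattice_points_axis[OF F_minus_1] by blast
qed

text \<open>A vector space is not the union of two proper subspaces, here the orthogonal complements of
  \<open>v\<close> and \<open>w\<close>.\<close>

lemma ex_common_nonorthogonal:
  assumes "v \<noteq> 0" "w \<noteq> 0" "finite_index_lattice V" "a \<in> F_minus"
  obtains u where "u \<in> V" "a *s u \<in> V" "\<omega> v u \<noteq> 0" "\<omega> w u \<noteq> 0"
proof -
  obtain x where x: "x \<in> lattice_points" "\<omega> v x \<noteq> 0"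
    using ex_lattice_point_nonorthogonal[OF assms(1)] .
  obtain y where y: "y \<in> lattice_points" "\<omega> w y \<noteq> 0"
    using ex_lattice_point_nonorthogonal[OF assms(2)] .
  have "\<exists>u\<in>{x, y, x + y}. \<omega> v u \<noteq> 0 \<and> \<omega> w u \<noteq> 0"
    using x y by (auto simp: add_right)
  then obtain u where u: "u \<in> lattice_points" "\<omega> v u \<noteq> 0" "\<omega> w u \<noteq> 0"
    using x y lattice_points_add by blast
  obtain s where s: "s \<in> F_minus" "s \<noteq> 0" "s *s u \<in> V" "s *s (a *s u) \<in> V"
    using finite_index_lattice_multiplier2[OF assms(3) u(1) lattice_points_scale[OF assms(4) u(1)]] .
  show thesis
  proof (rule that)
    show "s *s u \<in> V" using s by simp
    show "a *s (s *s u) \<in> V" using s(4) by (simp add: vector_smult_assoc mult.commute)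
    show "\<omega> v (s *s u) \<noteq> 0" "\<omega> w (s *s u) \<noteq> 0" using s u by (simp_all add: scale_right)
  qed
qed

lemma ex_nonorthogonal:
  assumes "v \<noteq> 0" "finite_index_lattice V"
  obtains u where "u \<in> V" "\<omega> v u \<noteq> 0"
  using ex_common_nonorthogonal[OF assms(1,1,2) F_minus_0] .

end

section \<open>Bijections that preserve equality of values of the form\<close>

text \<open>This is what remains of an isomorphism of subgroups of the Heisenberg group after dividing by
  the center: commutators are determined by the values of \<open>\<omega>\<close>, and an isomorphism preserves
  equality of commutators. The hypotheses are symmetric in \<open>f\<close> and its inverse.\<close>

locale form_value_bijection = integral_symplectic \<omega>
  for \<omega> :: "('a :: field) fls ^ 'n \<Rightarrow> 'a fls ^ 'n \<Rightarrow> 'a fls" +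
  fixes V1 V2 :: "('a fls ^ 'n) set" and f :: "'a fls ^ 'n \<Rightarrow> 'a fls ^ 'n"
  assumes V1: "finite_index_lattice V1" and V2: "finite_index_lattice V2"
    and bij: "bij_betw f V1 V2"
    and additive: "\<And>v w. v \<in> V1 \<Longrightarrow> w \<in> V1 \<Longrightarrow> f (v + w) = f v + f w"
    and form_values: "\<And>v w v' w'. v \<in> V1 \<Longrightarrow> w \<in> V1 \<Longrightarrow> v' \<in> V1 \<Longrightarrow> w' \<in> V1 \<Longrightarrow>
      \<omega> (f v) (f w) = \<omega> (f v') (f w') \<longleftrightarrow> \<omega> v w = \<omega> v' w'"
begin

lemma f_V2: "v \<in> V1 \<Longrightarrow> f v \<in> V2"
  using bij by (auto dest: bij_betwE)

lemma f_0: "f 0 = 0"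
  using additive[OF finite_index_lattice_0[OF V1] finite_index_lattice_0[OF V1]]
  by (metis add_0 add_cancel_right_right)

lemma f_eq_0_iff: "v \<in> V1 \<Longrightarrow> f v = 0 \<longleftrightarrow> v = 0"
  using bij finite_index_lattice_0[OF V1] f_0 unfolding bij_betw_def by (metis inj_onD)

lemma form_zero_iff: "v \<in> V1 \<Longrightarrow> w \<in> V1 \<Longrightarrow> \<omega> (f v) (f w) = 0 \<longleftrightarrow> \<omega> v w = 0"
  using form_values[of v w 0 0] finite_index_lattice_0[OF V1] by (simp add: f_0 zero_left)

lemma inverse: "form_value_bijection \<omega> V2 V1 (inv_into V1 f)"
proof unfold_locales
  let ?g = "inv_into V1 f"
  have g: "?g v \<in> V1" "f (?g v) = v" if "v \<in> V2" for v
    using that bij by (auto simp: bij_betw_def inv_into_into f_inv_into_f)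
  show "finite_index_lattice V2" "finite_index_lattice V1" by (fact V2 V1)+
  show "bij_betw ?g V2 V1" using bij by (rule bij_betw_inv_into)
  show "?g (v + w) = ?g v + ?g w" if "v \<in> V2" "w \<in> V2" for v w
  proof -
    have "f (?g v + ?g w) = v + w" using additive g that by simp
    moreover have "?g v + ?g w \<in> V1" using g that finite_index_lattice_add[OF V1] by blast
    ultimately show ?thesis using bij by (metis bij_betw_def inv_into_f_f)
  qed
  show "\<omega> (?g v) (?g w) = \<omega> (?g v') (?g w') \<longleftrightarrow> \<omega> v w = \<omega> v' w'"
    if "v \<in> V2" "w \<in> V2" "v' \<in> V2" "w' \<in> V2" for v w v' w'
    using form_values[of "?g v" "?g w" "?g v'" "?g w'"] g that by simp
qed

text \<open>\<open>a v\<close> is orthogonal to everything that is orthogonal to \<open>v\<close>. This property is preserved by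
  \<open>f\<close>, and its image says that \<open>f (a v)\<close> lies on the line of \<open>f v\<close>.\<close>

lemma maps_multiples_to_multiples:
  assumes v: "v \<in> V1" and av: "a *s v \<in> V1"
  obtains k where "f (a *s v) = k *s f v"
proof (cases "v = 0")
  case True
  then show thesis using that[of 0] by (simp add: f_0)
next
  case False
  then have "f v \<noteq> 0" using f_eq_0_iff[OF v] by simp
  then obtain y where y: "y \<in> V2" "\<omega> (f v) y \<noteq> 0" using ex_nonorthogonal[OF _ V2] by blast
  define k where "k = \<omega> (f (a *s v)) y / \<omega> (f v) y"
  have lp: "f v \<in> lattice_points" using finite_index_lattice_lattice_points[OF V2 f_V2[OF v]] .
  have "\<omega> (f (a *s v) - k *s f v) x = 0" if x: "x \<in> V2" for x
  proof -
    define p r where "p = \<omega> (f v) y" and "r = \<omega> (f v) x"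
    have xy: "x \<in> lattice_points" "y \<in> lattice_points"
      using x y finite_index_lattice_lattice_points[OF V2] by auto
    then have "p *s x \<in> lattice_points" "r *s y \<in> lattice_points"
      unfolding p_def r_def using integral lp by (auto intro: lattice_points_scale)
    then obtain s where s: "s \<in> F_minus" "s \<noteq> 0" "s *s (p *s x) \<in> V2" "s *s (r *s y) \<in> V2"
      by (rule finite_index_lattice_multiplier2[OF V2])
    \<comment> \<open>The combination of \<open>x\<close> and \<open>y\<close> that is orthogonal to \<open>f v\<close>.\<close>
    define z where "z = s *s (p *s x) - s *s (r *s y)"
    have z: "z \<in> V2" unfolding z_def using s by (intro finite_index_lattice_diff[OF V2])
    then obtain w where w: "w \<in> V1" "z = f w" using bij by (auto simp: bij_betw_def)
    have "\<omega> (f v) z = 0" by (simp add: z_def diff_right scale_right p_def r_def)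
    then have "\<omega> v w = 0" using form_zero_iff v w by simp
    then have "\<omega> (a *s v) w = 0" by (simp add: scale_left)
    then have "\<omega> (f (a *s v)) z = 0" using form_zero_iff av w by simp
    then have "s * (p * \<omega> (f (a *s v)) x - r * \<omega> (f (a *s v)) y) = 0"
      by (simp add: z_def diff_right scale_right algebra_simps)
    then have "p * \<omega> (f (a *s v)) x = r * \<omega> (f (a *s v)) y" using s by simp
    then show ?thesis
      using y by (simp add: diff_left scale_left k_def p_def r_def field_simps)
  qed
  then have "f (a *s v) - k *s f v = 0" using ex_nonorthogonal[OF _ V2] by metis
  then have "f (a *s v) = k *s f v" by simp
  then show thesis by (rule that)
qed

text \<open>The factor is the same for all nonzero vectors. For nonorthogonal \<open>v\<close> and \<open>w\<close> this follows from
  \<open>\<omega> (a v) w = \<omega> v (a w)\<close>; any two nonzero vectors have a common nonorthogonal vector.\<close>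

lemma multiple_unique_nonorthogonal:
  assumes "v \<in> V1" "w \<in> V1" "a *s v \<in> V1" "a *s w \<in> V1" "\<omega> v w \<noteq> 0"
    and "f (a *s v) = k *s f v" "f (a *s w) = l *s f w"
  shows "k = l"
proof -
  have "\<omega> (a *s v) w = \<omega> v (a *s w)" by (simp add: scale_left scale_right)
  then have "\<omega> (f (a *s v)) (f w) = \<omega> (f v) (f (a *s w))" using form_values assms by blast
  then have "k * \<omega> (f v) (f w) = l * \<omega> (f v) (f w)" by (simp add: assms scale_left scale_right)
  then show ?thesis using form_zero_iff assms by simp
qed

lemma multiple_unique:
  assumes "a \<in> F_minus"
    and v: "v \<in> V1" "a *s v \<in> V1" "v \<noteq> 0" "f (a *s v) = k *s f v"
    and w: "w \<in> V1" "a *s w \<in> V1" "w \<noteq> 0" "f (a *s w) = l *s f w"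
  shows "k = l"
proof -
  obtain u where u: "u \<in> V1" "a *s u \<in> V1" "\<omega> v u \<noteq> 0" "\<omega> w u \<noteq> 0"
    using ex_common_nonorthogonal[OF v(3) w(3) V1 assms(1)] .
  obtain m where "f (a *s u) = m *s f u" using maps_multiples_to_multiples[OF u(1,2)] .
  then show ?thesis using multiple_unique_nonorthogonal u v w by metis
qed

definition multiplier :: "'a fls \<Rightarrow> 'a fls" where
  "multiplier a = (SOME k. \<forall>v\<in>V1. a *s v \<in> V1 \<longrightarrow> f (a *s v) = k *s f v)"

lemma f_scale:
  assumes "a \<in> F_minus" "v \<in> V1" "a *s v \<in> V1"
  shows "f (a *s v) = multiplier a *s f v"
proof -
  have "\<exists>k. \<forall>v\<in>V1. a *s v \<in> V1 \<longrightarrow> f (a *s v) = k *s f v"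
  proof (cases "\<exists>v\<in>V1. a *s v \<in> V1 \<and> v \<noteq> 0")
    case True
    then obtain v k where v: "v \<in> V1" "a *s v \<in> V1" "v \<noteq> 0" "f (a *s v) = k *s f v"
      using maps_multiples_to_multiples by metis
    have "f (a *s w) = k *s f w" if w: "w \<in> V1" "a *s w \<in> V1" for w
    proof (cases "w = 0")
      case False
      obtain l where "f (a *s w) = l *s f w" using maps_multiples_to_multiples[OF w] .
      with multiple_unique[OF assms(1) v w False this] show ?thesis by blast
    qed (simp add: f_0)
    then show ?thesis by blast
  next
    case False
    have "f (a *s v) = 0 *s f v" if "v \<in> V1" "a *s v \<in> V1" for v
      using False that f_0 by (metis vector_smult_lzero vector_smult_rzero)
    then show ?thesis by blast
  qed
  then have "\<forall>v\<in>V1. a *s v \<in> V1 \<longrightarrow> f (a *s v) = multiplier a *s f v"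
    unfolding multiplier_def by (rule someI_ex)
  then show ?thesis using assms by blast
qed

lemma ex_test_vector:
  assumes "finite A" "A \<subseteq> F_minus"
  obtains v where "v \<noteq> 0" "v \<in> V1" "\<And>a. a \<in> A \<Longrightarrow> a *s v \<in> V1"
proof -
  define e :: "'a fls ^ 'n" where "e = axis undefined 1"
  have e: "e \<noteq> 0" "e \<in> lattice_points"
    by (simp_all add: e_def axis_eq_0_iff lattice_points_axis F_minus_1)
  have U: "finite (insert e ((\<lambda>a. a *s e) ` A))" "insert e ((\<lambda>a. a *s e) ` A) \<subseteq> lattice_points"
    using assms e by (auto intro: lattice_points_scale)
  obtain s where s: "s \<in> F_minus" "s \<noteq> 0" "\<And>u. u \<in> insert e ((\<lambda>a. a *s e) ` A) \<Longrightarrow> s *s u \<in> V1"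
    using finite_index_lattice_multiplier[OF V1 U] by blast
  show thesis
  proof (rule that)
    show "s *s e \<noteq> 0" using s e by simp
    show "s *s e \<in> V1" using s by blast
    fix a assume "a \<in> A"
    then have "s *s (a *s e) \<in> V1" using s by blast
    then show "a *s (s *s e) \<in> V1" by (simp add: vector_smult_assoc mult.commute)
  qed
qed

lemma ex_nonzero:
  obtains v where "v \<noteq> 0" "v \<in> V1"
  by (rule ex_test_vector[OF finite.emptyI empty_subsetI]) (rule that, assumption+)

lemma ex_test_vector2:
  assumes "a \<in> F_minus" "b \<in> F_minus"
  obtains v where "v \<noteq> 0" "v \<in> V1" "a *s v \<in> V1" "b *s v \<in> V1"
proof -
  have "finite {a, b}" "{a, b} \<subseteq> F_minus" using assms by auto
  then show thesis by (rule ex_test_vector) (rule that, auto)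
qed

lemma multiplier_eqI:
  assumes "a \<in> F_minus" "v \<in> V1" "a *s v \<in> V1" "v \<noteq> 0" "f (a *s v) = k *s f v"
  shows "multiplier a = k"
  using f_scale[OF assms(1-3)] assms f_eq_0_iff by simp

lemma multiplier_add:
  assumes a: "a \<in> F_minus" and b: "b \<in> F_minus"
  shows "multiplier (a + b) = multiplier a + multiplier b"
proof -
  obtain v where v: "v \<noteq> 0" "v \<in> V1" "a *s v \<in> V1" "b *s v \<in> V1"
    using ex_test_vector2[OF a b] .
  have "f ((a + b) *s v) = (multiplier a + multiplier b) *s f v"
    using v a b by (simp add: vector_sadd_rdistrib additive f_scale)
  moreover have "(a + b) *s v \<in> V1"
    using v finite_index_lattice_add[OF V1] by (simp add: vector_sadd_rdistrib)
  ultimately show ?thesis using v a b by (intro multiplier_eqI F_minus_add)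
qed

lemma multiplier_mult:
  assumes a: "a \<in> F_minus" and b: "b \<in> F_minus"
  shows "multiplier (a * b) = multiplier a * multiplier b"
proof -
  obtain v where v: "v \<noteq> 0" "v \<in> V1" "b *s v \<in> V1" "(a * b) *s v \<in> V1"
    using ex_test_vector2[OF b F_minus_mult[OF a b]] .
  have "f ((a * b) *s v) = (multiplier a * multiplier b) *s f v"
    using v a b f_scale[of a "b *s v"] f_scale[of b v] by (simp add: vector_smult_assoc)
  then show ?thesis using v a b by (intro multiplier_eqI F_minus_mult)
qed

text \<open>Evaluating at a nonzero vector gives a denominator for \<open>multiplier a\<close>. It depends on \<open>a\<close>, but for
  a fixed \<open>v \<noteq> 0\<close> one denominator serves for all \<open>a\<close> with \<open>a v \<in> V1\<close>, and finitely many further ones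
  serve for the remaining cosets.\<close>

lemma multiplier_common_denominator:
  obtains h where "h \<in> F_minus" "h \<noteq> 0" "\<forall>a\<in>F_minus. h * multiplier a \<in> F_minus"
proof -
  have coord: "\<exists>g. g \<in> F_minus \<and> g \<noteq> 0 \<and> (\<forall>a\<in>F_minus. a *s v \<in> V1 \<longrightarrow> g * multiplier a \<in> F_minus)"
    if v: "v \<in> V1" "v \<noteq> 0" for v
  proof -
    obtain i where i: "f v $ i \<noteq> 0" using f_eq_0_iff[OF v(1)] v(2) by (metis vec_eq_iff zero_index)
    have *: "f w $ i \<in> F_minus" if "w \<in> V1" for w
      using finite_index_lattice_lattice_points[OF V2 f_V2[OF that]] by (simp add: lattice_points_def)
    have "f v $ i * multiplier a \<in> F_minus" if "a \<in> F_minus" "a *s v \<in> V1" for a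
      using *[OF that(2)] f_scale[OF that(1) v(1) that(2)] by (simp add: mult.commute)
    then show ?thesis using i *[OF v(1)] by blast
  qed
  have each: "\<exists>g. g \<in> F_minus \<and> g \<noteq> 0 \<and> g * multiplier a \<in> F_minus" if "a \<in> F_minus" for a
    using ex_test_vector2[OF that that] coord that by metis
  then obtain d where d: "\<And>a. a \<in> F_minus \<Longrightarrow> d a \<in> F_minus \<and> d a \<noteq> 0 \<and> d a * multiplier a \<in> F_minus"
    by metis
  obtain v where v: "v \<noteq> 0" "v \<in> V1" by (rule ex_nonzero)
  obtain g where g: "g \<in> F_minus" "g \<noteq> 0" "\<And>a. a \<in> F_minus \<Longrightarrow> a *s v \<in> V1 \<Longrightarrow> g * multiplier a \<in> F_minus"
    using coord[OF v(2,1)] by blast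
  obtain q :: "'a fls ^ 'n \<Rightarrow> 'a fls ^ 'n" where q: "finite (q ` lattice_points)"
    "\<And>x y. x \<in> lattice_points \<Longrightarrow> y \<in> lattice_points \<Longrightarrow> q x = q y \<Longrightarrow> x - y \<in> V1"
    by (rule finite_index_lattice_classes[OF V1]) blast
  have lp: "a *s v \<in> lattice_points" if "a \<in> F_minus" for a
    using that v finite_index_lattice_lattice_points[OF V1] lattice_points_scale by blast
  define Q where "Q = (\<lambda>a. q (a *s v)) ` F_minus"
  have finQ: "finite Q" unfolding Q_def by (rule finite_subset[OF _ q(1)]) (auto intro: lp)
  have "\<forall>c\<in>Q. \<exists>a. a \<in> F_minus \<and> q (a *s v) = c" unfolding Q_def by blast
  then obtain r where r: "\<And>c. c \<in> Q \<Longrightarrow> r c \<in> F_minus \<and> q (r c *s v) = c" by metis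
  define h where "h = g * (\<Prod>c\<in>Q. d (r c))"
  show thesis
  proof (rule that)
    show "h \<in> F_minus" unfolding h_def using g r d by (intro F_minus_mult F_minus_prod) auto
    show "h \<noteq> 0" unfolding h_def using g r d finQ by simp
    show "\<forall>a\<in>F_minus. h * multiplier a \<in> F_minus"
    proof
    fix a :: "'a fls" assume a: "a \<in> F_minus"
    define c where "c = q (a *s v)"
    have c: "c \<in> Q" using a by (auto simp: c_def Q_def)
    have rc: "r c \<in> F_minus" "q (a *s v) = q (r c *s v)" using r[OF c] by (auto simp: c_def)
    have P: "(\<Prod>c\<in>Q. d (r c)) = d (r c) * (\<Prod>c\<in>Q - {c}. d (r c))" using finQ c by (rule prod.remove)
    have PF: "(\<Prod>c\<in>B. d (r c)) \<in> F_minus" if "B \<subseteq> Q" for B using that r d by (intro F_minus_prod) blast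
    have "(a - r c) *s v \<in> V1" using q(2)[OF lp[OF a] lp[OF rc(1)] rc(2)] by (simp add: vector_sub_rdistrib)
    then have 1: "g * multiplier (a - r c) \<in> F_minus" using g a rc by (intro g(3) F_minus_diff)
    have "multiplier a = multiplier (a - r c) + multiplier (r c)"
      using multiplier_add[OF F_minus_diff[OF a rc(1)] rc(1)] by simp
    then have "h * multiplier a = (\<Prod>c\<in>Q. d (r c)) * (g * multiplier (a - r c)) +
        g * (\<Prod>c\<in>Q - {c}. d (r c)) * (d (r c) * multiplier (r c))"
      unfolding h_def by (simp add: algebra_simps, simp add: P mult.assoc)
    also have "\<dots> \<in> F_minus" using F_minus_add[OF F_minus_mult[OF PF 1]
          F_minus_mult[OF F_minus_mult[OF g(1) PF]]] d[OF rc(1)] by blast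
    finally show "h * multiplier a \<in> F_minus" .
    qed
  qed
qed

lemma multiplier_F_minus: "a \<in> F_minus \<Longrightarrow> multiplier a \<in> F_minus"
proof -
  obtain h where h: "h \<in> F_minus" "h \<noteq> 0" "\<forall>a\<in>F_minus. h * multiplier a \<in> F_minus"
    using multiplier_common_denominator .
  have "multiplier ` F_minus \<subseteq> F_minus"
  proof (rule bounded_denominators_subset_F_minus[OF _ h(1,2)])
    fix x y assume "x \<in> multiplier ` F_minus" "y \<in> multiplier ` F_minus"
    then obtain a b where ab: "a \<in> F_minus" "b \<in> F_minus" "x = multiplier a" "y = multiplier b"
      by blast
    then have "x * y = multiplier (a * b)" using multiplier_mult by simp
    then show "x * y \<in> multiplier ` F_minus" using F_minus_mult[OF ab(1,2)] by blast
  qed (use h in blast)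
  then show "a \<in> F_minus \<Longrightarrow> multiplier a \<in> F_minus" by blast
qed

text \<open>\<open>f\<close> turns multiplication by \<open>a\<close> into multiplication by \<open>multiplier a\<close>, so its inverse turns the
  latter into the former.\<close>

lemma multiplier_inverse:
  assumes a: "a \<in> F_minus"
  shows "form_value_bijection.multiplier V2 (inv_into V1 f) (multiplier a) = a"
proof -
  interpret inv: form_value_bijection \<omega> V2 V1 "inv_into V1 f" by (rule inverse)
  have l: "inv_into V1 f (f v) = v" if "v \<in> V1" for v using that bij by (simp add: bij_betw_def)
  obtain v where v: "v \<noteq> 0" "v \<in> V1" "a *s v \<in> V1" "a *s v \<in> V1"
    using ex_test_vector2[OF a a] .
  have "f (a *s v) = multiplier a *s f v" using f_scale[OF a v(2,3)] .
  then have "multiplier a *s f v \<in> V2" "inv_into V1 f (multiplier a *s f v) = a *s inv_into V1 f (f v)"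
    using f_V2[OF v(3)] l v by (metis, metis)
  then show ?thesis
    using v f_V2 f_eq_0_iff a by (intro inv.multiplier_eqI[of _ "f v"] multiplier_F_minus) auto
qed

lemma multiplier_bij: "bij_betw multiplier F_minus F_minus"
proof -
  interpret inv: form_value_bijection \<omega> V2 V1 "inv_into V1 f" by (rule inverse)
  have eq: "inv_into V2 (inv_into V1 f) v = f v" if "v \<in> V1" for v
    using bij that by (simp add: inv_into_inv_into_eq)
  have "multiplier (inv.multiplier a) = a" if a: "a \<in> F_minus" for a
  proof -
    have iv: "inv_into V1 f w \<in> V1" "f (inv_into V1 f w) = w" if "w \<in> V2" for w
      using that bij by (auto simp: bij_betw_def inv_into_into f_inv_into_f)
    obtain w where w: "w \<noteq> 0" "w \<in> V2" "a *s w \<in> V2" "a *s w \<in> V2"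
      using inv.ex_test_vector2[OF a a] .
    let ?g = "inv_into V1 f"
    have "?g (a *s w) = inv.multiplier a *s ?g w" using inv.f_scale[OF a w(2,3)] .
    then have "inv.multiplier a *s ?g w \<in> V1" "f (inv.multiplier a *s ?g w) = a *s f (?g w)"
      using iv[OF w(3)] iv[OF w(2)] by (metis, metis)
    then show ?thesis
      using w iv inv.f_eq_0_iff a by (intro multiplier_eqI[of _ "?g w"] inv.multiplier_F_minus) auto
  qed
  then show ?thesis
    using multiplier_inverse multiplier_F_minus inv.multiplier_F_minus
    by (intro bij_betw_byWitness[of _ inv.multiplier]) auto
qed

end

section \<open>The semilinear map\<close>

definition vec_map :: "('k \<Rightarrow> 'k) \<Rightarrow> 'k ^ 'n \<Rightarrow> 'k ^ 'n" where
  "vec_map \<tau> v = (\<chi> i. \<tau> (v $ i))"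

lemma vec_map_nth [simp]: "vec_map \<tau> v $ i = \<tau> (v $ i)"
  by (simp add: vec_map_def)

lemma vec_map_scale:
  "field_automorphism \<tau> \<Longrightarrow> vec_map \<tau> (a *s v) = \<tau> a *s vec_map \<tau> v"
  by (simp add: vec_eq_iff field_automorphism_def)

lemma vec_map_sum:
  "field_automorphism \<tau> \<Longrightarrow> vec_map \<tau> (sum g A) = (\<Sum>i\<in>A. vec_map \<tau> (g i))"
  by (simp add: vec_eq_iff field_automorphism_sum)

abbreviation e where "e i \<equiv> axis i 1"

lemma scale_axis: "a *s e i = axis i (a :: 'a :: comm_ring_1)"
  by (simp add: vec_eq_iff axis_def)

lemma matrix_vector_mult_columns:
  "A *v x = (\<Sum>i\<in>UNIV. x $ i *s column i (A :: 'a :: comm_ring_1 ^ 'n ^ 'm))"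
  by (simp add: vec_eq_iff matrix_vector_mult_def column_def mult.commute)

lemma matrix_vector_mult_axis: "A *v e i = column i (A :: 'a :: comm_ring_1 ^ 'n ^ 'm)"
  by (simp add: vec_eq_iff matrix_vector_mult_def column_def axis_def if_distrib cong: if_cong)

locale semilinear_form_bijection = form_value_bijection \<omega> V1 V2 f
  for \<omega> :: "('a :: {field, finite}) fls ^ 'n \<Rightarrow> 'a fls ^ 'n \<Rightarrow> 'a fls" and V1 V2 f +
  fixes \<tau> :: "'a fls \<Rightarrow> 'a fls"
  assumes \<tau>_standard: "standard_field_automorphism \<tau>"
    and \<tau>_multiplier: "\<And>a. a \<in> F_minus \<Longrightarrow> \<tau> a = multiplier a"
    and \<tau>_form: "\<And>v w. \<omega> (vec_map \<tau> v) (vec_map \<tau> w) = \<tau> (\<omega> v w)"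
begin

lemma \<tau>_aut: "field_automorphism \<tau>"
  using \<tau>_standard by (simp add: standard_field_automorphism_def)

lemma \<tau>_mult: "\<tau> (a * b) = \<tau> a * \<tau> b"
  using \<tau>_aut by (simp add: field_automorphism_def)

lemma \<tau>_eq_0_iff: "\<tau> a = 0 \<longleftrightarrow> a = 0"
  using field_automorphism_inj[OF \<tau>_aut, of a 0] field_automorphism_0[OF \<tau>_aut] by simp

lemma \<tau>_inverse: "\<tau> (inverse a) = inverse (\<tau> a)"
proof (cases "a = 0")
  case False
  then have "\<tau> a * \<tau> (inverse a) = 1" by (simp add: field_automorphism_1[OF \<tau>_aut] flip: \<tau>_mult)
  then show ?thesis by (metis inverse_unique)
qed (simp add: field_automorphism_0[OF \<tau>_aut])

lemma \<tau>_F_minus: "a \<in> F_minus \<Longrightarrow> \<tau> a \<in> F_minus"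
  by (simp add: \<tau>_multiplier multiplier_F_minus)

definition \<tau>' where "\<tau>' = inv_into UNIV \<tau>"

lemma \<tau>_\<tau>': "\<tau> (\<tau>' a) = a"
  using \<tau>_aut by (simp add: \<tau>'_def field_automorphism_def bij_is_surj surj_f_inv_f)

lemma \<tau>'_F_minus: "a \<in> F_minus \<Longrightarrow> \<tau>' a \<in> F_minus"
proof -
  assume "a \<in> F_minus"
  then obtain b where b: "b \<in> F_minus" "a = multiplier b"
    using multiplier_bij by (auto simp: bij_betw_def)
  then have "\<tau> (\<tau>' a) = \<tau> b" by (simp add: \<tau>_\<tau>' \<tau>_multiplier)
  then show ?thesis using b by (simp add: field_automorphism_inj[OF \<tau>_aut])
qed

lemma \<tau>_scale: "a \<in> F_minus \<Longrightarrow> v \<in> V1 \<Longrightarrow> a *s v \<in> V1 \<Longrightarrow> f (a *s v) = \<tau> a *s f v"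
  by (simp add: f_scale \<tau>_multiplier)

lemma f_sum: "(\<And>i. i \<in> A \<Longrightarrow> g i \<in> V1) \<Longrightarrow> f (sum g A) = (\<Sum>i\<in>A. f (g i))"
  by (induction A rule: infinite_finite_induct)
    (simp_all add: f_0 additive finite_index_lattice_sum[OF V1])

text \<open>Semilinearity along the line of a lattice point \<open>u\<close> that need not lie in \<open>V1\<close>: both vectors
  are compared with \<open>s a b u\<close>, where \<open>s\<close> moves all that is needed into \<open>V1\<close>.\<close>

lemma f_proportional:
  assumes a: "a \<in> F_minus" and b: "b \<in> F_minus" and u: "u \<in> lattice_points"
    and au: "a *s u \<in> V1" and bu: "b *s u \<in> V1"
  shows "\<tau> b *s f (a *s u) = \<tau> a *s f (b *s u)"
proof -
  have "finite {a *s u, b *s u, (a * b) *s u}" "{a *s u, b *s u, (a * b) *s u} \<subseteq> lattice_points"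
    using a b u by (auto intro!: lattice_points_scale F_minus_mult)
  then obtain s where s: "s \<in> F_minus" "s \<noteq> 0"
    "\<And>w. w \<in> {a *s u, b *s u, (a * b) *s u} \<Longrightarrow> s *s w \<in> V1"
    using finite_index_lattice_multiplier[OF V1] by blast
  have "f ((s * a * b) *s u) = (\<tau> b * \<tau> s) *s f (a *s u)"
    using \<tau>_scale[OF b, of "s *s (a *s u)"] \<tau>_scale[OF s(1) au] s(3)[of "a *s u"]
      s(3)[of "(a * b) *s u"] by (simp add: vector_smult_assoc mult_ac)
  moreover have "f ((s * a * b) *s u) = (\<tau> a * \<tau> s) *s f (b *s u)"
    using \<tau>_scale[OF a, of "s *s (b *s u)"] \<tau>_scale[OF s(1) bu] s(3)[of "b *s u"]
      s(3)[of "(a * b) *s u"] by (simp add: vector_smult_assoc mult_ac)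
  ultimately have "\<tau> s *s (\<tau> b *s f (a *s u)) = \<tau> s *s (\<tau> a *s f (b *s u))"
    by (simp add: vector_smult_assoc mult_ac)
  then show ?thesis using s vector_mul_lcancel[of "\<tau> s"] \<tau>_eq_0_iff by blast
qed

definition den :: "'n \<Rightarrow> 'a fls" where
  "den i = (SOME d. d \<in> F_minus \<and> d \<noteq> 0 \<and> d *s e i \<in> V1)"

lemma den: "den i \<in> F_minus" "den i \<noteq> 0" "den i *s e i \<in> V1"
proof -
  have ei: "e i \<in> (lattice_points :: ('a fls ^ 'n) set)" by (rule lattice_points_axis[OF F_minus_1])
  obtain s where "s \<in> F_minus" "s \<noteq> 0" "s *s e i \<in> V1" "s *s e i \<in> V1"
    using finite_index_lattice_multiplier2[OF V1 ei ei] .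
  then have "\<exists>d. d \<in> F_minus \<and> d \<noteq> 0 \<and> d *s e i \<in> V1" by blast
  from someI_ex[OF this]
  show "den i \<in> F_minus" "den i \<noteq> 0" "den i *s e i \<in> V1" by (simp_all add: den_def)
qed

text \<open>Column \<open>i\<close> of the matrix is the value of \<open>\<tau>\<^sup>-\<^sup>1 \<circ> f\<close> at a multiple of the basis vector \<open>e\<^sub>i\<close> that
  lies in \<open>V1\<close>, divided by the factor.\<close>

definition T :: "'a fls ^ 'n ^ 'n" where
  "T = (\<chi> j i. inverse (den i) * \<tau>' (f (den i *s e i) $ j))"

lemma column_T: "vec_map \<tau> (column i T) = inverse (\<tau> (den i)) *s f (den i *s e i)"
  by (simp add: vec_eq_iff column_def T_def \<tau>_mult \<tau>_inverse \<tau>_\<tau>')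

text \<open>The second hypothesis says that the components of \<open>v\<close> along the basis vectors lie in \<open>V1\<close>, so
  that additivity of \<open>f\<close> reduces the claim to \<open>f_proportional\<close>.\<close>

lemma f_eq_T:
  assumes v: "v \<in> V1" and vi: "\<And>i. v $ i *s e i \<in> V1"
  shows "f v = vec_map \<tau> (T *v v)"
proof -
  have F: "v $ i \<in> F_minus" for i
    using finite_index_lattice_lattice_points[OF V1 v] by (simp add: lattice_points_def)
  have "f (v $ i *s e i) = vec_map \<tau> (v $ i *s column i T)" for i
  proof -
    have "\<tau> (den i) *s f (v $ i *s e i) = \<tau> (v $ i) *s f (den i *s e i)"
      by (rule f_proportional[OF F den(1) lattice_points_axis[OF F_minus_1] vi den(3)])
    then have "inverse (\<tau> (den i)) *s (\<tau> (den i) *s f (v $ i *s e i)) =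
        inverse (\<tau> (den i)) *s (\<tau> (v $ i) *s f (den i *s e i))" by simp
    then have "f (v $ i *s e i) = \<tau> (v $ i) *s (inverse (\<tau> (den i)) *s f (den i *s e i))"
      using den(2) by (simp add: vector_smult_assoc \<tau>_eq_0_iff mult.commute)
    then show ?thesis by (simp add: vec_map_scale[OF \<tau>_aut] column_T)
  qed
  then have "(\<Sum>i\<in>UNIV. f (v $ i *s e i)) = vec_map \<tau> (T *v v)"
    by (simp only: matrix_vector_mult_columns vec_map_sum[OF \<tau>_aut])
  moreover have "f v = (\<Sum>i\<in>UNIV. f (v $ i *s e i))"
    using f_sum[of UNIV "\<lambda>i. v $ i *s e i"] vi by (simp only: basis_expansion)
  ultimately show ?thesis by simp
qed

lemma f_axis_eq_T:
  assumes "a *s e i \<in> V1"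
  shows "f (a *s e i) = vec_map \<tau> (a *s column i T)"
proof -
  have "(a *s e i) $ j *s e j \<in> V1" for j
    using assms finite_index_lattice_0[OF V1] by (cases "i = j") (auto simp: axis_def)
  then have "f (a *s e i) = vec_map \<tau> (T *v (a *s e i))" using f_eq_T[OF assms] by blast
  then show ?thesis by (simp only: vector_scalar_commute matrix_vector_mult_axis)
qed

text \<open>At such vectors the values of the pulled back form are \<open>\<tau>\<^sup>-\<^sup>1 (\<omega> (f v) (f w))\<close>, because \<open>\<omega>\<close> commutes
  with \<open>\<tau>\<close>.\<close>

lemma pullback_values:
  assumes "a *s e i \<in> V1" "b *s e j \<in> V1" "a' *s e k \<in> V1" "b' *s e l \<in> V1"
  shows "a * b * \<omega> (column i T) (column j T) = a' * b' * \<omega> (column k T) (column l T) \<longleftrightarrow>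
    a * b * \<omega> (e i) (e j) = a' * b' * \<omega> (e k) (e l)"
  using form_values[OF assms]
  by (simp add: f_axis_eq_T assms \<tau>_form field_automorphism_inj[OF \<tau>_aut])
    (simp add: scale_left scale_right mult_ac)

text \<open>Cross-multiplied because entries of the Gram matrices may vanish.\<close>

lemma pullback_proportional:
  "\<omega> (e k) (e l) * \<omega> (column i T) (column j T) = \<omega> (e i) (e j) * \<omega> (column k T) (column l T)"
proof -
  let ?g = "\<omega> (e i) (e j)" and ?h = "\<omega> (e k) (e l)"
  have ax: "a *s e i \<in> (lattice_points :: ('a fls ^ 'n) set)" if "a \<in> F_minus" for a i
    using that by (simp add: scale_axis lattice_points_axis)
  have g: "?g \<in> F_minus" "?h \<in> F_minus"
    using integral lattice_points_axis[OF F_minus_1] by blast+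
  \<comment> \<open>The vectors \<open>a e\<^sub>i\<close>, \<open>b h e\<^sub>j\<close> and \<open>a e\<^sub>k\<close>, \<open>b g e\<^sub>l\<close> have the same value \<open>a b g h\<close> of \<open>\<omega>\<close>.\<close>
  obtain a where a: "a \<in> F_minus" "a \<noteq> 0" "a *s (1 *s e i) \<in> V1" "a *s (1 *s e k) \<in> V1"
    using finite_index_lattice_multiplier2[OF V1 ax[OF F_minus_1] ax[OF F_minus_1]] .
  obtain b where b: "b \<in> F_minus" "b \<noteq> 0" "b *s (?h *s e j) \<in> V1" "b *s (?g *s e l) \<in> V1"
    using finite_index_lattice_multiplier2[OF V1 ax[OF g(2)] ax[OF g(1)]] .
  have "a * (b * ?h) * \<omega> (column i T) (column j T) = a * (b * ?g) * \<omega> (column k T) (column l T)"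
    using a b by (subst pullback_values) (simp_all add: vector_smult_assoc mult_ac)
  then show ?thesis using a b by (simp add: mult.assoc)
qed

lemma pullback_zero_iff: "\<omega> (column i T) (column j T) = 0 \<longleftrightarrow> \<omega> (e i) (e j) = 0"
  using pullback_values[of "den i" i "den j" j 0 i 0 j] den finite_index_lattice_0[OF V1] by simp

lemma T_denominator:
  obtains b where "b \<in> F_minus" "b \<noteq> 0" "\<And>i j. b * T $ i $ j \<in> F_minus"
proof (rule that)
  define b where "b = (\<Prod>i\<in>UNIV. den i)"
  show "b \<in> F_minus" unfolding b_def by (intro F_minus_prod den)
  show "b \<noteq> 0" by (simp add: b_def den)
  fix i j
  have "b = den j * (\<Prod>i\<in>UNIV - {j}. den i)" unfolding b_def by (rule prod.remove) auto
  then have "b * T $ i $ j = (\<Prod>i\<in>UNIV - {j}. den i) * \<tau>' (f (den j *s e j) $ i)"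
    using den(2)[of j] by (simp add: T_def)
  moreover have "f (den j *s e j) $ i \<in> F_minus"
    using finite_index_lattice_lattice_points[OF V2 f_V2[OF den(3)]] by (simp add: lattice_points_def)
  ultimately show "b * T $ i $ j \<in> F_minus"
    using F_minus_mult[OF F_minus_prod[OF den(1)] \<tau>'_F_minus] by simp
qed

text \<open>The denominator \<open>h\<close> of the conformal factor is needed to bound the denominators of the central
  part of a virtual automorphism.\<close>

theorem T_conformal:
  obtains c h where "conformal_with \<omega> T c" "invertible T" "h \<in> F_minus" "h \<noteq> 0" "h * c \<in> F_minus"
proof -
  obtain k l where kl: "\<omega> (e k) (e l) \<noteq> 0"
  proof -
    obtain w where "\<omega> (e undefined) w \<noteq> 0"
      using ex_lattice_point_nonorthogonal[of "e undefined"] by (auto simp: axis_eq_0_iff)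
    then have "(\<Sum>j\<in>UNIV. w $ j * \<omega> (e undefined) (e j)) \<noteq> 0"
      by (metis (mono_tags, lifting) basis_expansion scale_right sum.cong sum_right)
    then obtain j where "\<omega> (e undefined) (e j) \<noteq> 0" by (metis (mono_tags, lifting) mult_zero_right sum.neutral)
    then show thesis by (rule that)
  qed
  define c where "c = \<omega> (column k T) (column l T) / \<omega> (e k) (e l)"
  have c: "\<omega> (column i T) (column j T) = c * \<omega> (e i) (e j)" for i j
    using pullback_proportional[of k l i j] kl by (simp add: c_def field_simps)
  have "\<omega> (T *v v) (T *v w) = c * \<omega> v w" for v w
  proof -
    have "\<omega> (T *v v) (T *v w) = c * (\<Sum>i\<in>UNIV. \<Sum>j\<in>UNIV. v $ i * w $ j * \<omega> (e i) (e j))"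
      unfolding matrix_vector_mult_columns form_combination c
      by (simp add: sum_distrib_left mult_ac)
    also have "\<dots> = c * \<omega> v w" by (simp only: basis_expansion flip: form_combination)
    finally show ?thesis .
  qed
  moreover have c0: "c \<noteq> 0" using kl by (simp add: c_def pullback_zero_iff)
  ultimately have conf: "conformal_with \<omega> T c" by (simp add: conformal_with_def)
  have "v = 0" if "T *v v = 0" for v
  proof (rule ccontr)
    assume "v \<noteq> 0"
    then obtain w where "\<omega> v w \<noteq> 0" using ex_lattice_point_nonorthogonal by blast
    then have "\<omega> (T *v v) (T *v w) \<noteq> 0" using conf c0 by (simp add: conformal_with_def)
    then show False by (simp add: that zero_left)
  qed
  then have inv: "invertible T"
    by (simp add: invertible_left_inverse matrix_left_invertible_injective vec.inj_iff_eq_0)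
  obtain b where b: "b \<in> F_minus" "b \<noteq> 0" "\<And>i j. b * T $ i $ j \<in> F_minus" by (rule T_denominator) blast
  define h where "h = b * b * \<omega> (e k) (e l)"
  have lp: "b *s column i T \<in> lattice_points" for i
    using b(3) by (simp add: lattice_points_def column_def)
  have "h * c = \<omega> (b *s column k T) (b *s column l T)"
    using kl by (simp add: h_def c_def scale_left scale_right)
  then have "h * c \<in> F_minus" using integral[OF lp lp] by simp
  moreover have "h \<in> F_minus" unfolding h_def
    using b integral[OF lattice_points_axis[OF F_minus_1] lattice_points_axis[OF F_minus_1]]
    by (intro F_minus_mult)
  moreover have "h \<noteq> 0" using b kl by (simp add: h_def)
  ultimately show thesis using that conf inv by blast
qed

lemma T_standard: "standard \<omega> T \<tau>"
proof -
  obtain b where b: "b \<in> F_minus" "b \<noteq> 0" "\<And>i j. b * T $ i $ j \<in> F_minus" by (rule T_denominator) blast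
  obtain c h where "conformal_with \<omega> T c" "invertible T" "h \<in> F_minus" "h \<noteq> 0" "h * c \<in> F_minus"
    using T_conformal .
  then show ?thesis
    using b \<tau>_standard
    unfolding standard_def conformally_symplectic_def standard_field_automorphism_def by blast
qed

end

section \<open>Subgroups of finite index\<close>

text \<open>Working criterion: finitely many classes such that elements in the same class differ by an
  element of the subgroup. Unlike cosets, classes may be as fine as is convenient.\<close>

context group
begin

lemma finite_indexI:
  assumes L: "subgroup L G" and K: "subgroup K G" "K \<subseteq> L"
    and fin: "finite (q ` L)"
    and q: "\<And>x y. x \<in> L \<Longrightarrow> y \<in> L \<Longrightarrow> q x = q y \<Longrightarrow> x \<otimes> inv y \<in> K"
  shows "finite_index G K L"
  unfolding finite_index_def
proof
  show "subgroup K (G\<lparr>carrier := L\<rparr>)" using subgroup_incl[OF K(1) L K(2)] .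
  have Lc: "x \<in> carrier G" if "x \<in> L" for x using subgroup.mem_carrier[OF L that] .
  have eq: "K #> x = K #> y" if "x \<in> L" "y \<in> L" "q x = q y" for x y
    using that q[OF that] Lc coset_join2[OF _ K(1), of "x \<otimes> inv y"] subgroup.subset[OF K(1)]
    by (intro coset_mult_inv1) auto
  define r where "r c = (SOME x. x \<in> L \<and> q x = c)" for c
  have r: "r (q x) \<in> L \<and> q (r (q x)) = q x" if "x \<in> L" for x
    unfolding r_def by (rule someI[of _ x]) (simp add: that)
  have "rcosets\<^bsub>G\<lparr>carrier := L\<rparr>\<^esub> K = (\<lambda>x. K #> x) ` L"
    by (auto simp: RCOSETS_def r_coset_def)
  also have "\<dots> \<subseteq> (\<lambda>c. K #> r c) ` (q ` L)" 
  proof (rule image_subsetI)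
    fix x assume "x \<in> L"
    then have "K #> x = K #> r (q x)" using r eq by metis
    then show "K #> x \<in> (\<lambda>c. K #> r c) ` (q ` L)" using \<open>x \<in> L\<close> by blast
  qed
  finally show "finite (rcosets\<^bsub>G\<lparr>carrier := L\<rparr>\<^esub> K)" using fin by (meson finite_imageI finite_subset)
qed

lemma finite_indexE:
  assumes L: "subgroup L G" and fi: "finite_index G K L"
  obtains q :: "'a \<Rightarrow> 'a set" where "subgroup K G" "K \<subseteq> L" "finite (q ` L)"
    "\<And>x y. x \<in> L \<Longrightarrow> y \<in> L \<Longrightarrow> q x = q y \<Longrightarrow> x \<otimes> inv y \<in> K"
proof -
  have sub: "subgroup K (G\<lparr>carrier := L\<rparr>)" using fi by (simp add: finite_index_def)
  then have K: "subgroup K G" "K \<subseteq> L" using incl_subgroup[OF L] subgroup.subset by fastforce+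
  show thesis
  proof (rule that[OF K])
    have "rcosets\<^bsub>G\<lparr>carrier := L\<rparr>\<^esub> K = (\<lambda>x. K #> x) ` L"
      by (auto simp: RCOSETS_def r_coset_def)
    then show "finite ((\<lambda>x. K #> x) ` L)" using fi by (simp add: finite_index_def)
    fix x y assume xy: "x \<in> L" "y \<in> L" "K #> x = K #> y"
    then have "x \<in> carrier G" "y \<in> carrier G" using subgroup.mem_carrier[OF L] by auto
    then show "x \<otimes> inv y \<in> K"
      using xy coset_mult_inv2[OF xy(3)] coset_join1[OF _ _ K(1)] subgroup.subset[OF K(1)] by simp
  qed
qed

lemma finite_index_subgroup: "subgroup L G \<Longrightarrow> finite_index G K L \<Longrightarrow> subgroup K G"
  and finite_index_subset: "subgroup L G \<Longrightarrow> finite_index G K L \<Longrightarrow> K \<subseteq> L"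
  by (erule (1) finite_indexE, assumption)+

lemma finite_index_restrict:
  assumes L: "subgroup L G" and M: "subgroup M G" "M \<subseteq> L" and fi: "finite_index G K L"
  shows "finite_index G (K \<inter> M) M"
proof -
  obtain q :: "'a \<Rightarrow> 'a set" where q: "subgroup K G" "K \<subseteq> L" "finite (q ` L)"
    "\<And>x y. x \<in> L \<Longrightarrow> y \<in> L \<Longrightarrow> q x = q y \<Longrightarrow> x \<otimes> inv y \<in> K"
    using L fi by (rule finite_indexE) blast
  show ?thesis
  proof (rule finite_indexI[OF M(1)])
    show "subgroup (K \<inter> M) G" using q(1) M(1) by (rule subgroups_Inter_pair)
    show "finite (q ` M)" using q(3) M(2) by (meson finite_subset image_mono)
    show "x \<otimes> inv y \<in> K \<inter> M" if "x \<in> M" "y \<in> M" "q x = q y" for x y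
      using that q(4) M by (meson IntI subgroup.m_closed subgroup.m_inv_closed subsetD)
  qed simp
qed

lemma finite_index_trans:
  assumes L: "subgroup L G" and M: "finite_index G M L" and K: "finite_index G K M"
  shows "finite_index G K L"
proof -
  obtain q :: "'a \<Rightarrow> 'a set" where q: "subgroup M G" "M \<subseteq> L" "finite (q ` L)"
    "\<And>x y. x \<in> L \<Longrightarrow> y \<in> L \<Longrightarrow> q x = q y \<Longrightarrow> x \<otimes> inv y \<in> M"
    using L M by (rule finite_indexE) blast
  obtain q' :: "'a \<Rightarrow> 'a set" where q': "subgroup K G" "K \<subseteq> M" "finite (q' ` M)"
    "\<And>x y. x \<in> M \<Longrightarrow> y \<in> M \<Longrightarrow> q' x = q' y \<Longrightarrow> x \<otimes> inv y \<in> K"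
    using q(1) K by (rule finite_indexE) blast
  define r where "r c = (SOME x. x \<in> L \<and> q x = c)" for c
  have r: "r (q x) \<in> L \<and> q (r (q x)) = q x" if "x \<in> L" for x
    unfolding r_def by (rule someI[of _ x]) (simp add: that)
  have rM: "x \<otimes> inv r (q x) \<in> M" if "x \<in> L" for x using q(4) r[OF that] that by simp
  show ?thesis
  proof (rule finite_indexI[OF L q'(1), where q = "\<lambda>x. (q x, q' (x \<otimes> inv r (q x)))"])
    show "K \<subseteq> L" using q q' by blast
    have "(\<lambda>x. (q x, q' (x \<otimes> inv r (q x)))) ` L \<subseteq> q ` L \<times> q' ` M" using rM by blast
    then show "finite ((\<lambda>x. (q x, q' (x \<otimes> inv r (q x)))) ` L)"
      using q(3) q'(3) by (meson finite_SigmaI finite_subset)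
    fix x y assume xy: "x \<in> L" "y \<in> L" "(q x, q' (x \<otimes> inv r (q x))) = (q y, q' (y \<otimes> inv r (q y)))"
    define s where "s = r (q x)"
    have s: "s \<in> L" using r[OF xy(1)] by (simp add: s_def)
    have c: "x \<in> carrier G" "y \<in> carrier G" "s \<in> carrier G"
      using xy s subgroup.mem_carrier[OF L] by auto
    have s': "s = r (q y)" using xy(3) by (simp add: s_def)
    have "q' (x \<otimes> inv s) = q' (y \<otimes> inv s)" using xy(3) s' s_def by (metis prod.inject)
    moreover have "x \<otimes> inv s \<in> M" using rM[OF xy(1)] by (simp add: s_def)
    moreover have "y \<otimes> inv s \<in> M" using rM[OF xy(2)] by (simp add: s')
    ultimately have "(x \<otimes> inv s) \<otimes> inv (y \<otimes> inv s) \<in> K" using q'(4) by blast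
    moreover have "(x \<otimes> inv s) \<otimes> inv (y \<otimes> inv s) = x \<otimes> inv y"
    proof -
      have "(x \<otimes> inv s) \<otimes> inv (y \<otimes> inv s) = (x \<otimes> inv s) \<otimes> (s \<otimes> inv y)"
        using c by (simp add: inv_mult_group)
      also have "\<dots> = (x \<otimes> inv s \<otimes> s) \<otimes> inv y" using c by (simp only: m_assoc inv_closed m_closed)
      also have "x \<otimes> inv s \<otimes> s = x" using c by (simp add: m_assoc)
      finally show ?thesis .
    qed
    ultimately show "x \<otimes> inv y \<in> K" by simp
  qed
qed

lemma finite_index_inter:
  assumes L: "subgroup L G" and "finite_index G K L" "finite_index G M L"
  shows "finite_index G (K \<inter> M) L"
  using finite_index_trans[OF L assms(3) finite_index_restrict[OF L _ _ assms(2)]]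
    finite_index_subgroup[OF L assms(3)] finite_index_subset[OF L assms(3)] by blast

lemma hom_inverse:
  assumes L: "subgroup L G" and h: "h \<in> hom (G\<lparr>carrier := L\<rparr>) G" and x: "x \<in> L"
  shows "h (inv x) = inv (h x)"
proof -
  note inv_eq = m_inv_consistent[OF L x]
  interpret group_hom "G\<lparr>carrier := L\<rparr>" G h
    using h subgroup.subgroup_is_group[OF L is_group] is_group
    by (simp add: group_hom_def group_hom_axioms_def)
  show ?thesis using hom_inv[of x] x inv_eq by simp
qed

lemma finite_index_vimage:
  assumes L: "subgroup L G" and M: "subgroup M G" and h: "h \<in> hom (G\<lparr>carrier := L\<rparr>) G"
    and hM: "\<And>x. x \<in> L \<Longrightarrow> h x \<in> M" and fi: "finite_index G K M"
  shows "finite_index G {x \<in> L. h x \<in> K} L"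
proof -
  obtain q :: "'a \<Rightarrow> 'a set" where q: "subgroup K G" "K \<subseteq> M" "finite (q ` M)"
    "\<And>x y. x \<in> M \<Longrightarrow> y \<in> M \<Longrightarrow> q x = q y \<Longrightarrow> x \<otimes> inv y \<in> K"
    using M fi by (rule finite_indexE) blast
  have mult: "h (x \<otimes> y) = h x \<otimes> h y" if "x \<in> L" "y \<in> L" for x y
    using h that by (simp add: hom_def)
  have inv: "h (inv x) = inv (h x)" if "x \<in> L" for x using hom_inverse[OF L h that] .
  have closed: "x \<otimes> y \<in> L" "inv x \<in> L" if "x \<in> L" "y \<in> L" for x y
    using that subgroup.m_closed[OF L] subgroup.m_inv_closed[OF L] by auto
  have one: "\<one> \<in> L" "h \<one> = \<one>"
    using subgroup.one_closed[OF L] mult[of \<one> "inv \<one>"] inv[of \<one>] hM[of \<one>] subgroup.mem_carrier[OF M]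
    by simp_all
  show ?thesis
  proof (rule finite_indexI[OF L])
    show "subgroup {x \<in> L. h x \<in> K} G"
    proof (rule subgroupI)
      show "{x \<in> L. h x \<in> K} \<subseteq> carrier G" using subgroup.subset[OF L] by blast
      show "{x \<in> L. h x \<in> K} \<noteq> {}" using one subgroup.one_closed[OF q(1)] by auto
    qed (use mult inv closed subgroup.m_closed[OF q(1)] subgroup.m_inv_closed[OF q(1)] in auto)
    have "(\<lambda>x. q (h x)) ` L \<subseteq> q ` M" using hM by blast
    then show "finite ((\<lambda>x. q (h x)) ` L)" using q(3) by (rule finite_subset)
    show "x \<otimes> inv y \<in> {x \<in> L. h x \<in> K}" if "x \<in> L" "y \<in> L" "q (h x) = q (h y)" for x y
      using that q(4)[OF hM hM] mult inv closed by simp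
  qed blast
qed

end

section \<open>The Heisenberg group\<close>

context integral_symplectic
begin

abbreviation H where "H \<equiv> heisenberg \<omega>"

lemma heisenberg_carrier: "carrier H = UNIV"
  and heisenberg_mult: "x \<otimes>\<^bsub>H\<^esub> y = (fst x + fst y, snd x + snd y + \<omega> (fst x) (fst y))"
  and heisenberg_one: "\<one>\<^bsub>H\<^esub> = (0, 0)"
  by (simp_all add: heisenberg_def split: prod.split)

lemma heisenberg_group: "group H"
proof (rule groupI)
  fix x
  have "(- fst x, - snd x) \<otimes>\<^bsub>H\<^esub> x = \<one>\<^bsub>H\<^esub>"
    by (simp add: heisenberg_mult heisenberg_one uminus_left alternating)
  then show "\<exists>y\<in>carrier H. y \<otimes>\<^bsub>H\<^esub> x = \<one>\<^bsub>H\<^esub>" by (auto simp: heisenberg_carrier)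
qed (simp_all add: heisenberg_carrier heisenberg_mult heisenberg_one add_left add_right zero_left add_ac)

sublocale H: group H by (rule heisenberg_group)

lemma heisenberg_inv: "inv\<^bsub>H\<^esub> x = (- fst x, - snd x)"
  by (rule H.inv_equality)
    (simp_all add: heisenberg_mult heisenberg_one heisenberg_carrier uminus_left alternating)

lemma heisenberg_mult_inv:
  "x \<otimes>\<^bsub>H\<^esub> inv\<^bsub>H\<^esub> y = (fst x - fst y, snd x - snd y - \<omega> (fst x) (fst y))"
  by (simp add: heisenberg_mult heisenberg_inv uminus_right)

lemma heisenberg_subgroupI:
  assumes "(0, 0) \<in> K" "\<And>x y. x \<in> K \<Longrightarrow> y \<in> K \<Longrightarrow> x \<otimes>\<^bsub>H\<^esub> inv\<^bsub>H\<^esub> y \<in> K"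
  shows "subgroup K H"
proof (rule H.subgroupI)
  show inv: "inv\<^bsub>H\<^esub> x \<in> K" if "x \<in> K" for x
    using assms(2)[OF assms(1) that] unfolding heisenberg_mult_inv by (simp add: heisenberg_inv zero_left)
  show "x \<otimes>\<^bsub>H\<^esub> y \<in> K" if "x \<in> K" "y \<in> K" for x y
    using assms(2)[OF that(1) inv[OF that(2)]] by (simp add: heisenberg_carrier)
qed (use assms in \<open>auto simp: heisenberg_carrier\<close>)

abbreviation \<Lambda> :: "(('a fls ^ 'n) \<times> 'a fls) set" where "\<Lambda> \<equiv> lattice_points \<times> F_minus"

lemma lattice_subgroup: "subgroup \<Lambda> H"
  by (rule heisenberg_subgroupI)
    (auto simp: heisenberg_mult_inv intro!: lattice_points_0 F_minus_0 lattice_points_diff F_minus_diff integral)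

lemma finite_index_lattice_projection:
  assumes fi: "finite_index H D \<Lambda>"
  shows "finite_index_lattice (fst ` D)"
proof -
  obtain q :: "('a fls ^ 'n) \<times> 'a fls \<Rightarrow> (('a fls ^ 'n) \<times> 'a fls) set" where q: "subgroup D H" "D \<subseteq> \<Lambda>" "finite (q ` \<Lambda>)"
    "\<And>x y. x \<in> \<Lambda> \<Longrightarrow> y \<in> \<Lambda> \<Longrightarrow> q x = q y \<Longrightarrow> x \<otimes>\<^bsub>H\<^esub> inv\<^bsub>H\<^esub> y \<in> D"
    using lattice_subgroup fi by (rule H.finite_indexE) blast
  have L: "(v, 0) \<in> \<Lambda>" if "v \<in> lattice_points" for v using that by (simp add: F_minus_0)
  define r where "r c = (SOME v. v \<in> lattice_points \<and> q (v, 0) = c)" for c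
  have r: "r (q (v, 0)) \<in> lattice_points \<and> q (r (q (v, 0)), 0) = q (v, 0)"
    if "v \<in> lattice_points" for v
    unfolding r_def by (rule someI[of _ v]) (simp add: that)
  define C where "C = r ` (q ` \<Lambda>)"
  have "\<exists>c\<in>C. v - c \<in> fst ` D" if v: "v \<in> lattice_points" for v
  proof
    have "(v, 0) \<otimes>\<^bsub>H\<^esub> inv\<^bsub>H\<^esub> (r (q (v, 0)), 0) \<in> D" using q(4) r[OF v] L v by simp
    then show "v - r (q (v, 0)) \<in> fst ` D" by (force simp: heisenberg_mult_inv)
    show "r (q (v, 0)) \<in> C" using L[OF v] by (auto simp: C_def)
  qed
  moreover have "finite C" using q(3) by (simp add: C_def)
  moreover have "fst x - fst y \<in> fst ` D" if "x \<in> D" "y \<in> D" for x y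
  proof -
    have "x \<otimes>\<^bsub>H\<^esub> inv\<^bsub>H\<^esub> y \<in> D"
      using that subgroup.m_closed[OF q(1)] subgroup.m_inv_closed[OF q(1)] by blast
    then show ?thesis by (force simp: heisenberg_mult_inv)
  qed
  moreover have "0 \<in> fst ` D" using subgroup.one_closed[OF q(1)] by (force simp: heisenberg_one)
  moreover have "fst ` D \<subseteq> lattice_points" using q(2) by auto
  ultimately show ?thesis unfolding finite_index_lattice_def by blast
qed

lemma eq_of_form_eq:
  assumes "finite_index_lattice V" "\<And>w. w \<in> V \<Longrightarrow> \<omega> (v - v') w = 0"
  shows "v = v'"
proof (rule ccontr)
  assume "v \<noteq> v'"
  then have "v - v' \<noteq> 0" by simp
  then obtain w where "w \<in> V" "\<omega> (v - v') w \<noteq> 0" using assms(1) by (rule ex_nonorthogonal)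
  with assms(2) show False by blast
qed

lemma hom_commutator:
  assumes L: "subgroup L H" and h: "h \<in> hom (H\<lparr>carrier := L\<rparr>) H" and x: "x \<in> L" and y: "y \<in> L"
  shows "(0, 2 * \<omega> (fst x) (fst y)) \<in> L"
    and "h (0, 2 * \<omega> (fst x) (fst y)) = (0, 2 * \<omega> (fst (h x)) (fst (h y)))"
proof -
  have comm: "(a \<otimes>\<^bsub>H\<^esub> b) \<otimes>\<^bsub>H\<^esub> inv\<^bsub>H\<^esub> (b \<otimes>\<^bsub>H\<^esub> a) = (0, 2 * \<omega> (fst a) (fst b))" for a b
    using skew[of "fst b" "fst a"]
    unfolding heisenberg_mult_inv
    by (simp add: heisenberg_mult add_left add_right alternating add.commute)
  have L2: "x \<otimes>\<^bsub>H\<^esub> y \<in> L" "y \<otimes>\<^bsub>H\<^esub> x \<in> L" "inv\<^bsub>H\<^esub> (y \<otimes>\<^bsub>H\<^esub> x) \<in> L"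
    using subgroup.m_closed[OF L] subgroup.m_inv_closed[OF L] x y by auto
  show "(0, 2 * \<omega> (fst x) (fst y)) \<in> L"
    using subgroup.m_closed[OF L L2(1,3)] by (simp only: comm)
  have mult: "h (a \<otimes>\<^bsub>H\<^esub> b) = h a \<otimes>\<^bsub>H\<^esub> h b" if "a \<in> L" "b \<in> L" for a b
    using h that by (simp add: hom_def)
  have "h ((x \<otimes>\<^bsub>H\<^esub> y) \<otimes>\<^bsub>H\<^esub> inv\<^bsub>H\<^esub> (y \<otimes>\<^bsub>H\<^esub> x)) =
      (h x \<otimes>\<^bsub>H\<^esub> h y) \<otimes>\<^bsub>H\<^esub> inv\<^bsub>H\<^esub> (h y \<otimes>\<^bsub>H\<^esub> h x)"
    using mult[OF L2(1,3)] mult[OF x y] mult[OF y x] H.hom_inverse[OF L h L2(2)] by simp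
  then show "h (0, 2 * \<omega> (fst x) (fst y)) = (0, 2 * \<omega> (fst (h x)) (fst (h y)))"
    by (simp only: comm)
qed

text \<open>An isomorphism of lattices preserves equality of commutators, hence equality of values of
  \<open>\<omega>\<close>. By nondegeneracy this also shows that the induced map modulo the center exists and is
  injective.\<close>

lemma isomorphism_induces_form_value_bijection:
  assumes two: "(2 :: 'a fls) \<noteq> 0"
    and D: "finite_index H D \<Lambda>" and D': "finite_index H D' \<Lambda>"
    and h: "h \<in> hom (H\<lparr>carrier := D\<rparr>) H" and bij: "bij_betw h D D'"
  obtains f where "form_value_bijection \<omega> (fst ` D) (fst ` D') f" "\<And>g. g \<in> D \<Longrightarrow> fst (h g) = f (fst g)"
proof -
  note V = finite_index_lattice_projection[OF D] and V' = finite_index_lattice_projection[OF D']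
  have Ds: "subgroup D H" using H.finite_index_subgroup[OF lattice_subgroup D] .
  have hD: "h x \<in> D'" if "x \<in> D" for x using bij that by (auto dest: bij_betwE)
  have form_iff: "\<omega> (fst (h x)) (fst (h y)) = \<omega> (fst (h x')) (fst (h y')) \<longleftrightarrow>
      \<omega> (fst x) (fst y) = \<omega> (fst x') (fst y')" (is "?l \<longleftrightarrow> ?r")
    if d: "x \<in> D" "y \<in> D" "x' \<in> D" "y' \<in> D" for x y x' y'
  proof -
    let ?c = "(0 :: 'a fls ^ 'n, 2 * \<omega> (fst x) (fst y))" and ?c' = "(0 :: 'a fls ^ 'n, 2 * \<omega> (fst x') (fst y'))"
    have c: "?c \<in> D" "?c' \<in> D" using hom_commutator(1)[OF Ds h] d by auto
    have "?l \<longleftrightarrow> h ?c = h ?c'" using hom_commutator(2)[OF Ds h] d two by simp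
    also have "\<dots> \<longleftrightarrow> ?c = ?c'" by (rule inj_on_eq_iff[OF bij_betw_imp_inj_on[OF bij] c])
    also have "\<dots> \<longleftrightarrow> ?r" using two by simp
    finally show ?thesis .
  qed
  have fst_iff: "fst (h x) = fst (h y) \<longleftrightarrow> fst x = fst y" if d: "x \<in> D" "y \<in> D" for x y
  proof
    assume eq: "fst (h x) = fst (h y)"
    have "\<omega> (fst x - fst y) w = 0" if "w \<in> fst ` D" for w
      using that form_iff[OF d(1) _ d(2)] eq by (auto simp: diff_left)
    then show "fst x = fst y" by (rule eq_of_form_eq[OF V])
  next
    assume eq: "fst x = fst y"
    have "\<omega> (fst (h x) - fst (h y)) w = 0" if "w \<in> fst ` D'" for w
    proof -
      obtain z where z: "z \<in> D" "w = fst (h z)" using \<open>w \<in> fst ` D'\<close> bij by (auto simp: bij_betw_def)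
      then show ?thesis using form_iff[OF d(1) z(1) d(2) z(1)] eq by (simp add: diff_left)
    qed
    then show "fst (h x) = fst (h y)" by (rule eq_of_form_eq[OF V'])
  qed
  define f where "f v = fst (h (SOME g. g \<in> D \<and> fst g = v))" for v
  have f: "fst (h g) = f (fst g)" if "g \<in> D" for g
  proof -
    let ?g = "SOME g'. g' \<in> D \<and> fst g' = fst g"
    have "?g \<in> D \<and> fst ?g = fst g" by (rule someI[of _ g]) (simp add: that)
    then show ?thesis unfolding f_def using fst_iff[of g ?g] that by simp
  qed
  have "form_value_bijection \<omega> (fst ` D) (fst ` D') f"
  proof unfold_locales
    show "bij_betw f (fst ` D) (fst ` D')"
      unfolding bij_betw_def
    proof
      show "inj_on f (fst ` D)" using fst_iff by (auto simp: inj_on_def simp flip: f)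
      have "f ` fst ` D = fst ` h ` D" by (auto simp: image_image f)
      then show "f ` fst ` D = fst ` D'" using bij by (simp add: bij_betw_def)
    qed
    show "f (v + w) = f v + f w" if vw: "v \<in> fst ` D" "w \<in> fst ` D" for v w
    proof -
      obtain x y where xy: "x \<in> D" "y \<in> D" "v = fst x" "w = fst y" using vw by blast
      have "x \<otimes>\<^bsub>H\<^esub> y \<in> D" using subgroup.m_closed[OF Ds] xy by blast
      then have "f (v + w) = fst (h (x \<otimes>\<^bsub>H\<^esub> y))" using f xy by (simp add: heisenberg_mult)
      also have "h (x \<otimes>\<^bsub>H\<^esub> y) = h x \<otimes>\<^bsub>H\<^esub> h y" using h xy by (simp add: hom_def)
      finally show ?thesis using f xy by (simp add: heisenberg_mult)
    qed
    show "\<omega> (f v) (f w) = \<omega> (f v') (f w') \<longleftrightarrow> \<omega> v w = \<omega> v' w'"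
      if vw: "v \<in> fst ` D" "w \<in> fst ` D" "v' \<in> fst ` D" "w' \<in> fst ` D" for v w v' w'
    proof -
      obtain x y x' y' where d: "x \<in> D" "y \<in> D" "x' \<in> D" "y' \<in> D"
        and "v = fst x" "w = fst y" "v' = fst x'" "w' = fst y'" using vw by blast
      then show ?thesis using form_iff[OF d] f by simp
    qed
  qed (fact V V')+
  then show thesis using that f by blast
qed

text \<open>In odd characteristic, all elements of \<open>H\<close> have finite order, so a group commensurable with \<open>\<Lambda>\<close>
  may contain elements whose coordinates are not even rational functions, and \<open>lam\<close> may map elements
  of \<open>\<Lambda>\<close> to such elements. Both are avoided on a subgroup of finite index.\<close>

lemma finite_index_integral_part:
  assumes \<Gamma>: "subgroup \<Gamma> H" and fi: "finite_index H (\<Gamma> \<inter> \<Lambda>) \<Gamma>"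
    and fi1: "finite_index H \<Gamma>1 \<Gamma>" and fi2: "finite_index H \<Gamma>2 \<Gamma>"
    and lam: "lam \<in> iso (H\<lparr>carrier := \<Gamma>1\<rparr>) (H\<lparr>carrier := \<Gamma>2\<rparr>)"
  shows "finite_index H {g \<in> \<Gamma>1. g \<in> \<Lambda> \<and> lam g \<in> \<Lambda>} \<Gamma>"
proof -
  have s: "subgroup \<Gamma>1 H" "subgroup \<Gamma>2 H" "\<Gamma>1 \<subseteq> \<Gamma>" "\<Gamma>2 \<subseteq> \<Gamma>"
    using H.finite_index_subgroup[OF \<Gamma>] H.finite_index_subset[OF \<Gamma>] fi1 fi2 by auto
  have l: "lam \<in> hom (H\<lparr>carrier := \<Gamma>1\<rparr>) H" "\<And>g. g \<in> \<Gamma>1 \<Longrightarrow> lam g \<in> \<Gamma>2"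
    using lam by (auto simp: iso_def hom_def heisenberg_carrier)
  have "finite_index H {g \<in> \<Gamma>1. lam g \<in> \<Gamma> \<inter> \<Lambda> \<inter> \<Gamma>2} \<Gamma>1"
    by (rule H.finite_index_vimage[OF s(1,2) l(1) l(2) H.finite_index_restrict[OF \<Gamma> s(2,4) fi]])
  then have "finite_index H ({g \<in> \<Gamma>1. lam g \<in> \<Gamma> \<inter> \<Lambda> \<inter> \<Gamma>2} \<inter> (\<Gamma> \<inter> \<Lambda> \<inter> \<Gamma>1)) \<Gamma>1"
    by (rule H.finite_index_inter[OF s(1) _ H.finite_index_restrict[OF \<Gamma> s(1,3) fi]])
  moreover have "{g \<in> \<Gamma>1. lam g \<in> \<Gamma> \<inter> \<Lambda> \<inter> \<Gamma>2} \<inter> (\<Gamma> \<inter> \<Lambda> \<inter> \<Gamma>1) = {g \<in> \<Gamma>1. g \<in> \<Lambda> \<and> lam g \<in> \<Lambda>}"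
    using s l by blast
  ultimately show ?thesis using H.finite_index_trans[OF \<Gamma> fi1] by simp
qed

lemma finite_index_lattice_of_finite_index:
  assumes \<Gamma>: "subgroup \<Gamma> H" and fi: "finite_index H (\<Gamma> \<inter> \<Lambda>) \<Lambda>"
    and D: "finite_index H D \<Gamma>" "D \<subseteq> \<Lambda>"
  shows "finite_index H D \<Lambda>"
proof -
  have s: "subgroup (\<Gamma> \<inter> \<Lambda>) H" using H.finite_index_subgroup[OF lattice_subgroup fi] .
  have "finite_index H (D \<inter> (\<Gamma> \<inter> \<Lambda>)) (\<Gamma> \<inter> \<Lambda>)"
    by (rule H.finite_index_restrict[OF \<Gamma> s _ D(1)]) blast
  moreover have "D \<inter> (\<Gamma> \<inter> \<Lambda>) = D" using H.finite_index_subset[OF \<Gamma> D(1)] D(2) by blast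
  ultimately show ?thesis using H.finite_index_trans[OF lattice_subgroup fi] by simp
qed

definition central_fractions :: "'a fls \<Rightarrow> (('a fls ^ 'n) \<times> 'a fls) set" where
  "central_fractions k = {g. fst g = 0 \<and> k * snd g \<in> F_minus}"

lemma central_fractions_subgroup: "subgroup (central_fractions k) H"
  by (rule heisenberg_subgroupI)
    (auto simp: central_fractions_def heisenberg_mult_inv F_minus_0 zero_left right_diff_distrib
      intro: F_minus_diff)

end

lemma finite_F_minus_subdegree_gt:
  "finite {f \<in> F_minus. f = 0 \<or> s < fls_subdegree (f :: 'a :: {field, finite} fls)}" (is "finite ?S")
proof (rule finite_imageD)
  let ?c = "\<lambda>f. restrict (fls_nth f) {s..0}"
  have "?c ` ?S \<subseteq> PiE {s..0} (\<lambda>_. UNIV)" by auto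
  then show "finite (?c ` ?S)" by (rule finite_subset) (intro finite_PiE, auto)
  show "inj_on ?c ?S"
  proof (rule inj_onI, rule fls_eqI)
    fix f g n assume fg: "f \<in> ?S" "g \<in> ?S" "?c f = ?c g"
    consider "n < s" | "s \<le> n" "n \<le> 0" | "n > 0" by linarith
    then show "f $$ n = g $$ n"
    proof cases
      case 2
      then show ?thesis using fun_cong[OF fg(3), of n] by simp
    qed (use fg in \<open>auto simp: F_minus_def\<close>)
  qed
qed

text \<open>\<open>k\<^sup>-\<^sup>1 F\<^sup>-\<close> modulo \<open>F\<^sup>-\<close> is finite because there are finitely many remainders modulo \<open>k\<close>.\<close>

lemma finite_index_central_fractions:
  fixes \<omega> :: "('a :: {field, finite}) fls ^ 'n \<Rightarrow> 'a fls ^ 'n \<Rightarrow> 'a fls"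
  assumes "integral_symplectic \<omega>"
    and D: "finite_index (heisenberg \<omega>) D (lattice_points \<times> F_minus)"
    and k: "k \<in> F_minus" "k \<noteq> 0"
  shows "finite_index (heisenberg \<omega>) (D \<inter> integral_symplectic.central_fractions k)
    (integral_symplectic.central_fractions k)"
proof -
  interpret integral_symplectic \<omega> by fact
  obtain q :: "('a fls ^ 'n) \<times> 'a fls \<Rightarrow> (('a fls ^ 'n) \<times> 'a fls) set"
    where q: "subgroup D H" "D \<subseteq> \<Lambda>" "finite (q ` \<Lambda>)"
    "\<And>x y. x \<in> \<Lambda> \<Longrightarrow> y \<in> \<Lambda> \<Longrightarrow> q x = q y \<Longrightarrow> x \<otimes>\<^bsub>H\<^esub> inv\<^bsub>H\<^esub> y \<in> D"
    using lattice_subgroup D by (rule H.finite_indexE) blast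
  have "\<forall>y. \<exists>r. y \<in> F_minus \<longrightarrow> r \<in> F_minus \<and> (y - k * r = 0 \<or> fls_subdegree k < fls_subdegree (y - k * r))"
    using F_minus_division[OF _ k] by metis
  then obtain r where r: "\<And>y. y \<in> F_minus \<Longrightarrow> r y \<in> F_minus \<and>
      (y - k * r y = 0 \<or> fls_subdegree k < fls_subdegree (y - k * r y))" by metis
  define S where "S = {f \<in> F_minus. f = 0 \<or> fls_subdegree k < fls_subdegree (f :: 'a fls)}"
  define quo where "quo g = (0 :: 'a fls ^ 'n, r (k * snd g))" for g :: "('a fls ^ 'n) \<times> 'a fls"
  define cl where "cl g = (k * snd g - k * snd (quo g), q (quo g))" for g
  have quo: "quo g \<in> \<Lambda>" "k * snd g - k * snd (quo g) \<in> S" if "g \<in> central_fractions k" for g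
    using that r[of "k * snd g"] k
    by (auto simp: central_fractions_def quo_def S_def lattice_points_0 intro!: F_minus_diff F_minus_mult)
  show ?thesis
  proof (rule H.finite_indexI[where q = cl])
    show "subgroup (central_fractions k) H" by (rule central_fractions_subgroup)
    then show "subgroup (D \<inter> central_fractions k) H" using q(1) by (intro H.subgroups_Inter_pair)
    have "cl ` central_fractions k \<subseteq> S \<times> q ` \<Lambda>" using quo by (auto simp: cl_def)
    moreover have "finite (S \<times> q ` \<Lambda>)"
      using q(3) finite_F_minus_subdegree_gt unfolding S_def by (intro finite_cartesian_product)
    ultimately show "finite (cl ` central_fractions k)" by (rule finite_subset)
    fix x y assume xy: "x \<in> central_fractions k" "y \<in> central_fractions k" "cl x = cl y"
    have "quo x \<otimes>\<^bsub>H\<^esub> inv\<^bsub>H\<^esub> quo y \<in> D" using q(4)[OF quo(1) quo(1)] xy by (simp add: cl_def)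
    moreover have "k * (snd x - snd y) = k * (snd (quo x) - snd (quo y))"
      using xy by (simp add: cl_def algebra_simps)
    then have "snd x - snd y = snd (quo x) - snd (quo y)" using k by simp
    then have "x \<otimes>\<^bsub>H\<^esub> inv\<^bsub>H\<^esub> y = quo x \<otimes>\<^bsub>H\<^esub> inv\<^bsub>H\<^esub> quo y"
      using xy by (simp add: heisenberg_mult_inv central_fractions_def quo_def zero_left)
    moreover have "x \<otimes>\<^bsub>H\<^esub> inv\<^bsub>H\<^esub> y \<in> central_fractions k"
      using xy subgroup.m_closed[OF central_fractions_subgroup]
        subgroup.m_inv_closed[OF central_fractions_subgroup] by blast
    ultimately show "x \<otimes>\<^bsub>H\<^esub> inv\<^bsub>H\<^esub> y \<in> D \<inter> central_fractions k" by simp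
  qed blast
qed

section \<open>Virtual automorphisms\<close>

text \<open>The hypothesis that standard automorphisms are automorphisms says, for the identity matrix, that
  \<open>\<omega>\<close> commutes with \<open>\<tau>\<close>: compare the central components of the images of \<open>(v, 0) (w, 0)\<close>.\<close>

lemma standard_automorphism_preserves_form:
  fixes \<omega> :: "('a :: {field, finite}) fls ^ 'n \<Rightarrow> 'a fls ^ 'n \<Rightarrow> 'a fls"
  assumes \<omega>: "symplectic_form \<omega>"
    and aut: "\<And>T \<tau>. standard \<omega> T \<tau> \<Longrightarrow> phi \<omega> T \<tau> \<in> hom (heisenberg \<omega>) (heisenberg \<omega>)"
    and \<tau>: "standard_field_automorphism \<tau>"
  shows "\<omega> (vec_map \<tau> v) (vec_map \<tau> w) = \<tau> (\<omega> v w)"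
proof -
  have conf: "conformal_with \<omega> (mat 1) 1" by (simp add: conformal_with_def)
  have "invertible (mat 1 :: 'a fls ^ 'n ^ 'n)" by (auto simp: invertible_def intro: exI[of _ "mat 1"])
  then have "conformally_symplectic \<omega> (mat 1)"
    unfolding conformally_symplectic_def using conf by blast
  moreover have "\<exists>b\<in>F_minus. b \<noteq> 0 \<and> (\<forall>i j. b * (mat 1 :: 'a fls ^ 'n ^ 'n) $ i $ j \<in> F_minus)"
    by (rule bexI[of _ 1]) (simp_all add: mat_def F_minus_0 F_minus_1)
  ultimately have "standard \<omega> (mat 1) \<tau>"
    using \<tau> unfolding standard_def standard_field_automorphism_def by blast
  from aut[OF this] have "phi \<omega> (mat 1) \<tau> ((v, 0) \<otimes>\<^bsub>heisenberg \<omega>\<^esub> (w, 0)) =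
      phi \<omega> (mat 1) \<tau> (v, 0) \<otimes>\<^bsub>heisenberg \<omega>\<^esub> phi \<omega> (mat 1) \<tau> (w, 0)"
    by (rule hom_mult) (simp_all add: heisenberg_def)
  then show ?thesis
    using conformal_factor_eq[OF \<omega> conf] \<tau>
    by (simp add: heisenberg_def phi_def vec_map_def standard_field_automorphism_def field_automorphism_0)
qed

lemma phi_eq:
  assumes "symplectic_form \<omega>" "conformal_with \<omega> T c"
  shows "phi \<omega> T \<tau> g = (vec_map \<tau> (T *v fst g), \<tau> (c * snd g))"
  by (cases g) (simp add: phi_def vec_map_def conformal_factor_eq[OF assms])

text \<open>The characteristic divides \<open>p\<^sup>r\<close>, which is odd.\<close>

lemma two_neq_zero:
  assumes "prime p" "p > 2" "CARD('a :: {field, finite}) = p ^ r"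
  shows "(2 :: 'a fls) \<noteq> 0"
proof
  assume "(2 :: 'a fls) = 0"
  then have "((1 + 1) :: 'a fls) $$ 0 = 0" by (simp only: one_add_one fls_zero_nth)
  then have "of_nat 2 = (0 :: 'a)" by simp
  then have "CHAR('a) dvd 2" by (simp only: of_nat_eq_0_iff_char_dvd)
  moreover have "CHAR('a) \<noteq> 1" by simp
  ultimately have "CHAR('a) = 2" using prime_nat_iff two_is_prime_nat by blast
  then have "2 dvd p ^ r" using CHAR_dvd_CARD[where 'a = 'a] assms(3) by simp
  then have "2 dvd p" using prime_dvd_power two_is_prime_nat by blast
  then show False using primes_dvd_imp_eq[OF two_is_prime_nat assms(1)] assms(2) by simp
qed

text \<open>On the subgroup of finite index on which the automorphism induces a semilinear map modulo the
  center, it differs from \<open>\<phi>\<close> by a homomorphism \<open>\<zeta>\<close> into the center of \<open>H\<close>. The values of \<open>\<zeta>\<close>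
  have a common denominator, so that those in \<open>K\<close> are attained on a subgroup of finite index.\<close>

lemma (in semilinear_form_bijection) difference_to_standard:
  assumes D: "finite_index H D \<Lambda>" and V1_eq: "V1 = fst ` D"
    and lam: "lam \<in> hom (H\<lparr>carrier := D\<rparr>) H" and lam_D: "\<And>g. g \<in> D \<Longrightarrow> lam g \<in> \<Lambda>"
    and lam_f: "\<And>g. g \<in> D \<Longrightarrow> fst (lam g) = f (fst g)"
    and K: "finite_index H K \<Lambda>"
  obtains D' \<zeta> where "finite_index H D' D" "\<zeta> \<in> hom (H\<lparr>carrier := D'\<rparr>) H"
    "\<And>g. g \<in> D' \<Longrightarrow> \<zeta> g \<in> K \<and> fst (\<zeta> g) = 0"
    "\<And>g. g \<in> D' \<Longrightarrow> lam g = phi \<omega> T \<tau> g \<otimes>\<^bsub>H\<^esub> \<zeta> g"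
proof -
  obtain c h where c: "conformal_with \<omega> T c" "invertible T" "h \<in> F_minus" "h \<noteq> 0" "h * c \<in> F_minus"
    using T_conformal .
  have \<tau>_add: "\<tau> (a + b) = \<tau> a + \<tau> b" for a b using \<tau>_aut by (simp add: field_automorphism_def)
  have Ds: "subgroup D H" "D \<subseteq> \<Lambda>"
    using H.finite_index_subgroup[OF lattice_subgroup D] H.finite_index_subset[OF lattice_subgroup D] .
  \<comment> \<open>The subgroup on which \<open>f_eq_T\<close> applies.\<close>
  define E where "E = {g \<in> D. \<forall>i. fst g $ i *s e i \<in> V1}"
  have D_diff: "x \<otimes>\<^bsub>H\<^esub> inv\<^bsub>H\<^esub> y \<in> D" if "x \<in> D" "y \<in> D" for x y
    using that subgroup.m_closed[OF Ds(1)] subgroup.m_inv_closed[OF Ds(1)] by blast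
  have Es: "subgroup E H"
  proof (rule heisenberg_subgroupI)
    show "(0, 0) \<in> E"
      using subgroup.one_closed[OF Ds(1)] finite_index_lattice_0[OF V1] by (simp add: E_def heisenberg_one)
    fix x y assume xy: "x \<in> E" "y \<in> E"
    have "fst x $ i *s e i - fst y $ i *s e i \<in> V1" for i
      using xy finite_index_lattice_diff[OF V1] by (simp add: E_def)
    then show "x \<otimes>\<^bsub>H\<^esub> inv\<^bsub>H\<^esub> y \<in> E"
      using D_diff[of x y] xy by (simp add: E_def heisenberg_mult_inv vector_sub_rdistrib)
  qed
  have E: "finite_index H E D"
  proof -
    obtain q :: "'a fls ^ 'n \<Rightarrow> 'a fls ^ 'n" where q: "finite (q ` lattice_points)"
      "\<And>x y. x \<in> lattice_points \<Longrightarrow> y \<in> lattice_points \<Longrightarrow> q x = q y \<Longrightarrow> x - y \<in> V1"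
      by (rule finite_index_lattice_classes[OF V1]) blast
    define cl where "cl g = (\<lambda>i. q (fst g $ i *s e i))" for g :: "('a fls ^ 'n) \<times> 'a fls"
    have lp: "fst g $ i *s e i \<in> lattice_points" if "g \<in> D" for g i
      using that Ds(2) by (auto simp: scale_axis lattice_points_def axis_def F_minus_0)
    show ?thesis
    proof (rule H.finite_indexI[OF Ds(1) Es, where q = cl])
      have "cl ` D \<subseteq> PiE UNIV (\<lambda>_. q ` lattice_points)" using lp by (auto simp: cl_def)
      moreover have "finite (PiE (UNIV :: 'n set) (\<lambda>_. q ` lattice_points))"
        using q(1) by (intro finite_PiE) auto
      ultimately show "finite (cl ` D)" by (rule finite_subset)
      fix x y assume xy: "x \<in> D" "y \<in> D" "cl x = cl y"
      have "fst x $ i *s e i - fst y $ i *s e i \<in> V1" for i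
        using q(2)[OF lp[OF xy(1)] lp[OF xy(2)]] fun_cong[OF xy(3), of i] by (simp add: cl_def)
      then show "x \<otimes>\<^bsub>H\<^esub> inv\<^bsub>H\<^esub> y \<in> E"
        using D_diff xy by (simp add: E_def heisenberg_mult_inv vector_sub_rdistrib)
    qed (auto simp: E_def)
  qed
  have fst_lam: "fst (lam g) = vec_map \<tau> (T *v fst g)" if "g \<in> E" for g
    using that f_eq_T[of "fst g"] lam_f by (auto simp: E_def V1_eq)
  define \<zeta> where "\<zeta> g = (0 :: 'a fls ^ 'n, snd (lam g) - \<tau> (c * snd g))" for g
  have lam_eq: "lam g = phi \<omega> T \<tau> g \<otimes>\<^bsub>H\<^esub> \<zeta> g" if "g \<in> E" for g
    using fst_lam[OF that]
    by (simp add: phi_eq[OF symplectic c(1)] heisenberg_mult \<zeta>_def zero_right prod_eq_iff)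
  have \<zeta>_hom: "\<zeta> \<in> hom (H\<lparr>carrier := E\<rparr>) H"
  proof -
    have "\<zeta> (x \<otimes>\<^bsub>H\<^esub> y) = \<zeta> x \<otimes>\<^bsub>H\<^esub> \<zeta> y" if xy: "x \<in> E" "y \<in> E" for x y
    proof -
      have "lam (x \<otimes>\<^bsub>H\<^esub> y) = lam x \<otimes>\<^bsub>H\<^esub> lam y" using lam xy by (simp add: hom_def E_def)
      moreover have "\<omega> (fst (lam x)) (fst (lam y)) = \<tau> (c * \<omega> (fst x) (fst y))"
        using c(1) by (simp add: fst_lam xy \<tau>_form conformal_with_def)
      ultimately show ?thesis
        by (simp add: \<zeta>_def heisenberg_mult zero_left distrib_left \<tau>_add)
    qed
    then show ?thesis by (simp add: hom_def heisenberg_carrier)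
  qed
  \<comment> \<open>A common denominator of the values of \<open>\<zeta>\<close>.\<close>
  define k where "k = \<tau> h"
  have k: "k \<in> F_minus" "k \<noteq> 0" using c by (simp_all add: k_def \<tau>_F_minus \<tau>_eq_0_iff)
  have \<zeta>_frac: "\<zeta> g \<in> central_fractions k" if "g \<in> E" for g
  proof -
    have g: "g \<in> D" using that by (simp add: E_def)
    have "k * \<tau> (c * snd g) = \<tau> ((h * c) * snd g)" by (simp add: k_def \<tau>_mult mult.assoc)
    also have "\<dots> \<in> F_minus" using Ds(2) g by (intro \<tau>_F_minus F_minus_mult[OF c(5)]) auto
    finally have "k * \<tau> (c * snd g) \<in> F_minus" .
    moreover have "k * snd (lam g) \<in> F_minus" using lam_D[OF g] k by (auto intro: F_minus_mult)
    ultimately show ?thesis by (simp add: central_fractions_def \<zeta>_def right_diff_distrib F_minus_diff)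
  qed
  define D' where "D' = {g \<in> E. \<zeta> g \<in> K \<inter> central_fractions k}"
  have "finite_index H D' E" unfolding D'_def
    by (rule H.finite_index_vimage[OF Es central_fractions_subgroup \<zeta>_hom \<zeta>_frac
          finite_index_central_fractions[OF integral_symplectic_axioms K k]])
  then have "finite_index H D' D" by (rule H.finite_index_trans[OF Ds(1) E])
  moreover have "\<zeta> \<in> hom (H\<lparr>carrier := D'\<rparr>) H" using \<zeta>_hom by (simp add: hom_def D'_def heisenberg_carrier)
  moreover have "\<zeta> g \<in> K \<and> fst (\<zeta> g) = 0" if "g \<in> D'" for g using that by (simp add: D'_def \<zeta>_def)
  moreover have "lam g = phi \<omega> T \<tau> g \<otimes>\<^bsub>H\<^esub> \<zeta> g" if "g \<in> D'" for g using that lam_eq by (simp add: D'_def)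
  ultimately show thesis by (rule that)
qed

theorem theorem1p15:
  fixes p r m :: nat
    and \<omega> :: "('a :: {field, finite}) fls ^ 'n \<Rightarrow> 'a fls ^ 'n \<Rightarrow> 'a fls"
    and \<Gamma> \<Gamma>1 \<Gamma>2 :: "(('a fls ^ 'n) \<times> 'a fls) set"
    and lam :: "('a fls ^ 'n) \<times> 'a fls \<Rightarrow> ('a fls ^ 'n) \<times> 'a fls"
  assumes "prime p" and "p > 2" and "CARD('a) = p ^ r"
    and "m \<ge> 1" and "CARD('n) = 2 * m"
    and "symplectic_form \<omega>"
    and "\<forall>v \<in> lattice_points. \<forall>w \<in> lattice_points. \<omega> v w \<in> F_minus"
    and standard_aut: "\<forall>T \<tau>. standard \<omega> T \<tau> \<longrightarrow> phi \<omega> T \<tau> \<in> iso (heisenberg \<omega>) (heisenberg \<omega>)"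
    and "arithmetic_subgroup \<omega> \<Gamma>"
    and "virtual_automorphism (heisenberg \<omega>) \<Gamma> \<Gamma>1 \<Gamma>2 lam"
  shows "\<exists>T \<tau> \<Gamma>' \<zeta>.
           standard \<omega> T \<tau> \<and>
           finite_index (heisenberg \<omega>) \<Gamma>' \<Gamma> \<and> \<Gamma>' \<subseteq> \<Gamma>1 \<and>
           \<zeta> \<in> hom ((heisenberg \<omega>)\<lparr>carrier := \<Gamma>'\<rparr>)
                  ((heisenberg \<omega>)\<lparr>carrier := subgroup_center (heisenberg \<omega>) \<Gamma>\<rparr>) \<and>
           (\<forall>\<gamma> \<in> \<Gamma>'. lam \<gamma> = phi \<omega> T \<tau> \<gamma> \<otimes>\<^bsub>heisenberg \<omega>\<^esub> \<zeta> \<gamma>)"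
proof -
  interpret integral_symplectic \<omega> using assms(6,7) by unfold_locales auto
  have \<Gamma>: "subgroup \<Gamma> H" and comm: "finite_index H (\<Gamma> \<inter> \<Lambda>) \<Gamma>" "finite_index H (\<Gamma> \<inter> \<Lambda>) \<Lambda>"
    using assms(9) by (auto simp: arithmetic_subgroup_def commensurable_def)
  have fi: "finite_index H \<Gamma>1 \<Gamma>" "finite_index H \<Gamma>2 \<Gamma>"
    and lam: "lam \<in> iso (H\<lparr>carrier := \<Gamma>1\<rparr>) (H\<lparr>carrier := \<Gamma>2\<rparr>)"
    using assms(10) by (auto simp: virtual_automorphism_def)
  have s1: "subgroup \<Gamma>1 H" using H.finite_index_subgroup[OF \<Gamma> fi(1)] .
  have bij: "bij_betw lam \<Gamma>1 \<Gamma>2" and hom1: "lam \<in> hom (H\<lparr>carrier := \<Gamma>1\<rparr>) (H\<lparr>carrier := \<Gamma>2\<rparr>)"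
    using lam by (auto simp: iso_def)
  have lam': "inv_into \<Gamma>1 lam \<in> iso (H\<lparr>carrier := \<Gamma>2\<rparr>) (H\<lparr>carrier := \<Gamma>1\<rparr>)"
    using group.iso_set_sym[OF H.subgroup_imp_group[OF s1] lam] by simp
  \<comment> \<open>\<open>lam\<close> restricts to an isomorphism from \<open>D\<close> to \<open>D2\<close>, and both have finite index in \<open>\<Lambda>\<close>.\<close>
  define D where "D = {g \<in> \<Gamma>1. g \<in> \<Lambda> \<and> lam g \<in> \<Lambda>}"
  define D2 where "D2 = {g \<in> \<Gamma>2. g \<in> \<Lambda> \<and> inv_into \<Gamma>1 lam g \<in> \<Lambda>}"
  have D_\<Gamma>: "finite_index H D \<Gamma>" unfolding D_def
    by (rule finite_index_integral_part[OF \<Gamma> comm(1) fi lam])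
  then have D: "finite_index H D \<Lambda>"
    by (rule finite_index_lattice_of_finite_index[OF \<Gamma> comm(2)]) (auto simp: D_def)
  have "finite_index H D2 \<Gamma>" unfolding D2_def
    by (rule finite_index_integral_part[OF \<Gamma> comm(1) fi(2,1) lam'])
  then have D2: "finite_index H D2 \<Lambda>"
    by (rule finite_index_lattice_of_finite_index[OF \<Gamma> comm(2)]) (auto simp: D2_def)
  have lam_D: "lam \<in> hom (H\<lparr>carrier := D\<rparr>) H"
    using hom1 by (auto simp: hom_def D_def heisenberg_carrier)
  have bij_D: "bij_betw lam D D2"
  proof (rule bij_betw_byWitness[where f' = "inv_into \<Gamma>1 lam"])
    have *: "inv_into \<Gamma>1 lam (lam g) = g" if "g \<in> \<Gamma>1" for g
      using bij that by (simp add: bij_betw_def)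
    have **: "lam (inv_into \<Gamma>1 lam g) = g" "inv_into \<Gamma>1 lam g \<in> \<Gamma>1" if "g \<in> \<Gamma>2" for g
      using bij that by (auto simp: bij_betw_def f_inv_into_f inv_into_into)
    show "\<forall>g\<in>D. inv_into \<Gamma>1 lam (lam g) = g" using * by (auto simp: D_def)
    show "\<forall>g\<in>D2. lam (inv_into \<Gamma>1 lam g) = g" using ** by (auto simp: D2_def)
    show "lam ` D \<subseteq> D2"
    proof (rule image_subsetI)
      fix g assume "g \<in> D"
      then show "lam g \<in> D2" using *[of g] bij_betwE[OF bij] by (simp add: D_def D2_def)
    qed
    show "inv_into \<Gamma>1 lam ` D2 \<subseteq> D"
    proof (rule image_subsetI)
      fix g assume "g \<in> D2"
      then show "inv_into \<Gamma>1 lam g \<in> D" using **[of g] by (simp add: D_def D2_def)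
    qed
  qed
  obtain f where f: "form_value_bijection \<omega> (fst ` D) (fst ` D2) f"
    "\<And>g. g \<in> D \<Longrightarrow> fst (lam g) = f (fst g)"
    using isomorphism_induces_form_value_bijection[OF two_neq_zero[OF assms(1-3)] D D2 lam_D bij_D]
    by blast
  interpret f: form_value_bijection \<omega> "fst ` D" "fst ` D2" f by (fact f(1))
  obtain \<tau> where \<tau>: "standard_field_automorphism \<tau>" "\<And>a. a \<in> F_minus \<Longrightarrow> \<tau> a = f.multiplier a"
    using ring_automorphism_F_minus_extends[OF f.multiplier_bij f.multiplier_add f.multiplier_mult] by blast
  interpret s: semilinear_form_bijection \<omega> "fst ` D" "fst ` D2" f \<tau>
  proof unfold_locales
    show "\<omega> (vec_map \<tau> v) (vec_map \<tau> w) = \<tau> (\<omega> v w)" for v w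
      using standard_aut by (intro standard_automorphism_preserves_form[OF assms(6) _ \<tau>(1)]) (auto simp: iso_def)
  qed (fact \<tau>)+
  obtain \<Gamma>' \<zeta> where \<Gamma>': "finite_index H \<Gamma>' D" and \<zeta>: "\<zeta> \<in> hom (H\<lparr>carrier := \<Gamma>'\<rparr>) H"
    "\<And>g. g \<in> \<Gamma>' \<Longrightarrow> \<zeta> g \<in> \<Gamma> \<inter> \<Lambda> \<and> fst (\<zeta> g) = 0"
    and eq: "\<And>g. g \<in> \<Gamma>' \<Longrightarrow> lam g = phi \<omega> s.T \<tau> g \<otimes>\<^bsub>H\<^esub> \<zeta> g"
    using s.difference_to_standard[OF D refl lam_D _ f(2) comm(2)] by (auto simp: D_def)
  have "finite_index H \<Gamma>' \<Gamma>" by (rule H.finite_index_trans[OF \<Gamma> D_\<Gamma> \<Gamma>'])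
  moreover have "\<Gamma>' \<subseteq> \<Gamma>1"
    using H.finite_index_subset[OF H.finite_index_subgroup[OF \<Gamma> D_\<Gamma>] \<Gamma>'] by (auto simp: D_def)
  moreover have "\<zeta> g \<in> subgroup_center H \<Gamma>" if "g \<in> \<Gamma>'" for g
    using \<zeta>(2)[OF that] by (simp add: subgroup_center_def heisenberg_mult zero_left zero_right add.commute)
  then have "\<zeta> \<in> hom (H\<lparr>carrier := \<Gamma>'\<rparr>) (H\<lparr>carrier := subgroup_center H \<Gamma>\<rparr>)"
    using \<zeta>(1) by (simp add: hom_def)
  ultimately show ?thesis using s.T_standard eq by blast
qed

end
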